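(* Let $f$ be a dimension function with $f(x)/x^4$ decreasing (in $x>0$) and $f(x)/x^4\to\infty$ as $x\to0$, and let $\Psi\colon\mathbb{N}\to(0,\infty)$ be an approximation function. (i) If $\sum_{m=1}^\infty m^7 f(\Psi(m))<\infty$, then $\mathscr{H}^f(\mathcal{W}(\Psi))=\mathscr{H}^f(\mathcal{V}(\Psi))=0$. (ii) If $\Psi$ is decreasing and $\sum_{m=1}^\infty m^7 f(\Psi(m))=\infty$, then $\mathscr{H}^f(\mathcal{W}(\Psi))=\mathscr{H}^f(\mathcal{V}(\Psi))=\infty$.
   Context: $\mathbb{H}$ denotes the real quaternions $\xi=a+bi+cj+dk$, identified with $\mathbb{R}^4$, with Euclidean norm $|\xi|_2=(a^2+b^2+c^2+d^2)^{1/2}$. The Hurwitz integers $\mathcal{H}$ are the quaternions $a+bi+cj+dk$ with either all of $a,b,c,d\in\mathbb{Z}$ or all of $a,b,c,d\in\mathbb{Z}+\frac12$. Let $\overline\Delta=[0,1]^3\times[0,1/2]\subset\mathbb{H}$. An approximation function is a function $\Psi\colon\mathbb{N}\to(0,\infty)$ with $\Psi(m)\to0$ as $m\to\infty$; it is extended to real $x\ge 1$ by $\Psi(x)=\Psi([x])$, $[x]$ being the integer part. Define $$\mathcal{W}(\Psi)=\{\xi\in\mathbb{H}: |\xi-\mathbf{p}\mathbf{q}^{-1}|_2<\Psi(|\mathbf{q}|_2)\text{ for infinitely many pairs }\mathbf{p},\mathbf{q}\in\mathcal{H},\ \mathbf{q}\ne0\}$$ (pairs are not required to be coprime) and $\mathcal{V}(\Psi)=\mathcal{W}(\Psi)\cap\overline\Delta$.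 A dimension function is a continuous increasing function $f\colon[0,\infty)\to[0,\infty)$ with $f(x)>0$ for $x>0$ and $f(x)\to0$ as $x\to0$ (so $f(0)=0$). The Hausdorff $f$-measure of a set $E$ is $\mathscr{H}^f(E)=\lim_{\varepsilon\to0}\inf\sum_i f(\operatorname{diam} C_i)$, the infimum being over countable covers $\{C_i\}$ of $E$ with $\operatorname{diam} C_i\le\varepsilon$. "Decreasing" means non-increasing. *)

theory Defs
  imports "HOL-Analysis.Analysis"
begin

section \<open>Quaternions\<close>

text \<open>
  The quaternion a + bi + cj + dk is the vector with components a, b, c, d (indices 1, 2, 3, 4),
  so that norm, distance and topology are the Euclidean ones. The operation (*) that the library
  provides on this type is componentwise and is never used here.
\<close>

type_synonym quat = "real ^ 4"

definition qmult :: "quat \<Rightarrow> quat \<Rightarrow> quat"  (infixl "\<odot>" 70) where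
  "p \<odot> q = vector
     [p$1 * q$1 - p$2 * q$2 - p$3 * q$3 - p$4 * q$4,
      p$1 * q$2 + p$2 * q$1 + p$3 * q$4 - p$4 * q$3,
      p$1 * q$3 - p$2 * q$4 + p$3 * q$1 + p$4 * q$2,
      p$1 * q$4 + p$2 * q$3 - p$3 * q$2 + p$4 * q$1]"

definition qone :: quat where
  "qone = vector [1, 0, 0, 0]"

definition qcnj :: "quat \<Rightarrow> quat" where
  "qcnj q = vector [q$1, - q$2, - q$3, - q$4]"

definition qinv :: "quat \<Rightarrow> quat" where
  "qinv q = (1 / (norm q)\<^sup>2) *\<^sub>R qcnj q"

lemma vector_4 [simp]:
  "(vector [a, b, c, d] :: 'a::zero ^ 4) $ 1 = a"
  "(vector [a, b, c, d] :: 'a ^ 4) $ 2 = b"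
  "(vector [a, b, c, d] :: 'a ^ 4) $ 3 = c"
  "(vector [a, b, c, d] :: 'a ^ 4) $ 4 = d"
  unfolding vector_def by simp_all

lemma qnorm_sq: "(norm (q::quat))\<^sup>2 = (q$1)\<^sup>2 + (q$2)\<^sup>2 + (q$3)\<^sup>2 + (q$4)\<^sup>2"
  by (simp add: norm_vec_def L2_set_def sum_4)

lemma qmult_units:
  defines "i \<equiv> vector [0, 1, 0, 0]" and "j \<equiv> vector [0, 0, 1, 0]" and "k \<equiv> vector [0, 0, 0, 1]"
  shows "i \<odot> i = - qone" "j \<odot> j = - qone" "k \<odot> k = - qone"
    "i \<odot> j = k" "j \<odot> k = i" "k \<odot> i = j"
    "j \<odot> i = - k" "k \<odot> j = - i" "i \<odot> k = - j"
  unfolding i_def j_def k_def by (simp_all add: qmult_def qone_def vec_eq_iff forall_4)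

lemma qmult_assoc: "(p \<odot> q) \<odot> r = p \<odot> (q \<odot> r)"
  by (simp add: qmult_def vec_eq_iff forall_4 algebra_simps)

lemma qmult_qone [simp]: "qone \<odot> q = q" "q \<odot> qone = q"
  by (simp_all add: qmult_def qone_def vec_eq_iff forall_4)

lemma norm_qmult: "norm (p \<odot> q) = norm p * norm q"
proof -
  have "(norm (p \<odot> q))\<^sup>2 = (norm p * norm q)\<^sup>2"
    unfolding power_mult_distrib qnorm_sq by (simp add: qmult_def) algebra
  then show ?thesis by simp
qed

lemma qmult_qinv:
  assumes "q \<noteq> 0"
  shows "q \<odot> qinv q = qone" "qinv q \<odot> q = qone"
proof -
  have n: "(norm q)\<^sup>2 \<noteq> 0" using assms by simp
  have "q \<odot> qcnj q = (norm q)\<^sup>2 *\<^sub>R qone" "qcnj q \<odot> q = (norm q)\<^sup>2 *\<^sub>R qone"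
    unfolding qnorm_sq
    by (simp_all add: qmult_def qcnj_def qone_def vec_eq_iff forall_4 power2_eq_square)
  moreover have "q \<odot> (c *\<^sub>R r) = c *\<^sub>R (q \<odot> r)" "(c *\<^sub>R r) \<odot> q = c *\<^sub>R (r \<odot> q)" for c r
    by (simp_all add: qmult_def vec_eq_iff forall_4 algebra_simps)
  ultimately show "q \<odot> qinv q = qone" "qinv q \<odot> q = qone"
    using n by (simp_all add: qinv_def)
qed

definition hurwitz :: "quat set" where
  "hurwitz = {q. (\<forall>i. q$i \<in> \<int>) \<or> (\<forall>i. q$i - 1/2 \<in> \<int>)}"

definition Delta_bar :: "quat set" where
  "Delta_bar = {\<xi>. \<xi>$1 \<in> {0..1} \<and> \<xi>$2 \<in> {0..1} \<and> \<xi>$3 \<in> {0..1} \<and> \<xi>$4 \<in> {0..1/2}}"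


section \<open>Approximation functions and approximable quaternions\<close>

text \<open>
  Here the natural numbers are the positive ones: nothing is required of the value at 0, and that
  value never enters below, since nonzero Hurwitz integers have norm at least 1.
\<close>

definition approximation_function :: "(nat \<Rightarrow> real) \<Rightarrow> bool" where
  "approximation_function \<Psi> \<longleftrightarrow> (\<forall>m\<ge>1. 0 < \<Psi> m) \<and> \<Psi> \<longlonglongrightarrow> 0"

definition approximable :: "(nat \<Rightarrow> real) \<Rightarrow> quat set" where
  "approximable \<Psi> = {\<xi>. infinite {(p, q). p \<in> hurwitz \<and> q \<in> hurwitz \<and> q \<noteq> 0 \<and>
       norm (\<xi> - p \<odot> qinv q) < \<Psi> (nat \<lfloor>norm q\<rfloor>)}}"

definition approximable_Delta :: "(nat \<Rightarrow> real) \<Rightarrow> quat set" where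
  "approximable_Delta \<Psi> = approximable \<Psi> \<inter> Delta_bar"


section \<open>Hausdorff measures\<close>

definition dimension_function :: "(real \<Rightarrow> real) \<Rightarrow> bool" where
  "dimension_function f \<longleftrightarrow>
     continuous_on {0..} f \<and> mono_on {0..} f \<and> f ` {0..} \<subseteq> {0..} \<and>
     (\<forall>x>0. 0 < f x) \<and> (f \<longlongrightarrow> 0) (at_right 0)"

text \<open>
  Boundedness of the covering sets is required explicitly because the library's diameter of an
  unbounded set is an unspecified real number. Covers are indexed by the natural numbers;
  finite covers are included by padding with the empty set, which has diameter 0 and hence
  contributes f 0 = 0 when f is a dimension function.
\<close>

definition hausdorff_pre :: "(real \<Rightarrow> real) \<Rightarrow> real \<Rightarrow> 'a::metric_space set \<Rightarrow> ennreal" where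
  "hausdorff_pre f \<epsilon> E =
     (INF C \<in> {C :: nat \<Rightarrow> 'a set. E \<subseteq> (\<Union>i. C i) \<and> (\<forall>i. bounded (C i) \<and> diameter (C i) \<le> \<epsilon>)}.
        \<Sum>i. ennreal (f (diameter (C i))))"

definition hausdorff_measure :: "(real \<Rightarrow> real) \<Rightarrow> 'a::metric_space set \<Rightarrow> ennreal" where
  "hausdorff_measure f E = Lim (at_right 0) (\<lambda>\<epsilon>. hausdorff_pre f \<epsilon> E)"

lemma dimension_function_0: "dimension_function f \<Longrightarrow> f 0 = 0"
proof -
  assume f: "dimension_function f"
  then have "continuous (at 0 within {0..}) f"
    by (simp add: dimension_function_def continuous_on_eq_continuous_within)
  then have "(f \<longlongrightarrow> f 0) (at 0 within {0<..})"
    unfolding continuous_within by (rule tendsto_within_subset) auto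
  moreover have "(f \<longlongrightarrow> 0) (at_right 0)"
    using f by (simp add: dimension_function_def)
  ultimately show "f 0 = 0"
    using tendsto_unique trivial_limit_at_right_real by blast
qed

lemma hausdorff_pre_antimono: "\<epsilon> \<le> \<delta> \<Longrightarrow> hausdorff_pre f \<delta> E \<le> hausdorff_pre f \<epsilon> E"
  unfolding hausdorff_pre_def by (intro INF_superset_mono) (auto intro: order_trans)

text \<open>The limit in the definition always exists.\<close>

lemma hausdorff_pre_tendsto:
  "((\<lambda>\<epsilon>. hausdorff_pre f \<epsilon> E) \<longlongrightarrow> (SUP \<epsilon>\<in>{0<..}. hausdorff_pre f \<epsilon> E)) (at_right 0)"
proof (rule order_tendstoI)
  fix a assume "a < (SUP \<epsilon>\<in>{0<..}. hausdorff_pre f \<epsilon> E)"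
  then obtain d where d: "d > 0" "a < hausdorff_pre f d E"
    by (auto simp: less_SUP_iff)
  then have "a < hausdorff_pre f e E" if "e \<in> {0<..<d}" for e
    using hausdorff_pre_antimono[of e d f E] that by (auto intro: less_le_trans)
  then show "\<forall>\<^sub>F e in at_right 0. a < hausdorff_pre f e E"
    using d(1) by (auto simp: eventually_at_right_field)
next
  fix a assume a: "(SUP \<epsilon>\<in>{0<..}. hausdorff_pre f \<epsilon> E) < a"
  have "hausdorff_pre f e E < a" if "e > 0" for e
    using that by (intro le_less_trans[OF SUP_upper a]) auto
  then show "\<forall>\<^sub>F e in at_right 0. hausdorff_pre f e E < a"
    by (auto simp: eventually_at_right_field intro: exI[of _ 1])
qed

lemma hausdorff_measure_SUP: "hausdorff_measure f E = (SUP \<epsilon>\<in>{0<..}. hausdorff_pre f \<epsilon> E)"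
  unfolding hausdorff_measure_def
  by (intro tendsto_Lim hausdorff_pre_tendsto) simp

end

theory Submission
  imports Defs
begin

text \<open>
  Part (i) covers a bounded part of the approximable set by the balls around \<open>p q\<^sup>-\<^sup>1\<close>; packing bounds
  give \<open>O(m\<^sup>7)\<close> pairs whose denominator has norm of integer part \<open>m\<close>.

  Part (ii) is a direct version of the mass transference principle. By Dirichlet's theorem the
  quotients \<open>p q\<^sup>-\<^sup>1\<close> with denominators of size about \<open>N = 8\<^sup>k\<close> come within \<open>128 / N\<^sup>2\<close> of at least half
  of every ball, once \<open>N\<close> is large. Enlarging the approximation radius \<open>\<rho>\<close> to \<open>R\<close> with \<open>R\<^sup>4\<close> proportional
  to \<open>f \<rho>\<close>, divergence of the series yields, in any ball of radius \<open>r\<close>, finitely many disjoint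
  enlarged balls of total volume at least a fixed multiple of \<open>r\<^sup>4\<close>. Given a cover of finite
  \<open>f\<close>-mass by small sets, a ball that meets little of its mass, relative to its volume, then contains
  one of the small balls of radius \<open>\<rho>\<close> that meets less than \<open>f \<rho> / 2\<^sup>2\<^sup>6\<close>. Iterating gives nested
  balls shrinking to an approximable point that no set of the cover contains.
\<close>


section \<open>Hurwitz integers\<close>

lemma qmult_diff_right: "(a - b) \<odot> c = a \<odot> c - b \<odot> c"
  by (simp add: qmult_def vec_eq_iff forall_4 algebra_simps)

lemma qmult_diff_left: "a \<odot> (b - c) = a \<odot> b - a \<odot> c"
  by (simp add: qmult_def vec_eq_iff forall_4 algebra_simps)

lemma norm_qinv: "norm (qinv q) = 1 / norm q"
\<comment> \<open>At \<open>q = 0\<close> both sides are 0, because division by zero yields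
  0.\<close>
proof (cases "q = 0")
  case True
  then show ?thesis by (simp add: qinv_def)
next
  case False
  then have "norm q * norm (qinv q) = norm qone"
    by (metis norm_qmult qmult_qinv(1))
  moreover have "(norm qone)\<^sup>2 = 1"
    unfolding qnorm_sq by (simp add: qone_def)
  then have "norm qone = 1"
    by (simp add: power2_eq_1_iff) (smt (verit) norm_ge_zero)
  ultimately show ?thesis using False by (simp add: field_simps)
qed

text \<open>Denominators stand on the right, so right multiplication by \<open>q\<close> clears
  them, and the norm is multiplicative. This converts bounds on \<open>\<xi> \<odot> q - p\<close>,
  as Dirichlet's theorem supplies, into distances to fractions.\<close>

lemma norm_diff_fraction:
  assumes "q \<noteq> 0"
  shows "norm (\<xi> - p \<odot> qinv q) = norm (\<xi> \<odot> q - p) / norm q"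
proof -
  have "\<xi> - p \<odot> qinv q = (\<xi> \<odot> q - p) \<odot> qinv q"
    using assms by (simp add: qmult_diff_right qmult_assoc qmult_qinv)
  then show ?thesis by (simp add: norm_qmult norm_qinv)
qed

lemma norm_fraction: "norm (p \<odot> qinv q) = norm p / norm q"
  by (simp add: norm_qmult norm_qinv)

lemma hurwitz_diff:
  assumes "p \<in> hurwitz" "q \<in> hurwitz" shows "p - q \<in> hurwitz"
proof -
  consider "\<forall>i. p$i \<in> \<int>" "\<forall>i. q$i \<in> \<int>" | "\<forall>i. p$i \<in> \<int>" "\<forall>i. q$i - 1/2 \<in> \<int>"
    | "\<forall>i. p$i - 1/2 \<in> \<int>" "\<forall>i. q$i \<in> \<int>" | "\<forall>i. p$i - 1/2 \<in> \<int>" "\<forall>i. q$i - 1/2 \<in> \<int>"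
    using assms by (auto simp: hurwitz_def)
  then show ?thesis
  proof cases
    case 1
    then show ?thesis by (auto simp: hurwitz_def)
  next
    case 2
    then have "p$i - (q$i - 1/2) - 1 \<in> \<int>" for i by (blast intro: Ints_diff Ints_1)
    moreover have "p$i - (q$i - 1/2) - 1 = (p - q)$i - 1/2" for i by simp
    ultimately have "(p - q)$i - 1/2 \<in> \<int>" for i by metis
    then show ?thesis unfolding hurwitz_def by blast
  next
    case 3
    then have "(p$i - 1/2) - q$i \<in> \<int>" for i by (blast intro: Ints_diff)
    moreover have "(p$i - 1/2) - q$i = (p - q)$i - 1/2" for i by simp
    ultimately have "(p - q)$i - 1/2 \<in> \<int>" for i by metis
    then show ?thesis unfolding hurwitz_def by blast
  next
    case 4
    then have "(p$i - 1/2) - (q$i - 1/2) \<in> \<int>" for i by (blast intro: Ints_diff)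
    moreover have "(p$i - 1/2) - (q$i - 1/2) = (p - q)$i" for i by simp
    ultimately have "(p - q)$i \<in> \<int>" for i by metis
    then show ?thesis unfolding hurwitz_def by blast
  qed
qed

text \<open>With integral components, some nonzero one has modulus at least 1; with half-integral
  components, all four squares are at least 1/4.\<close>

lemma norm_hurwitz_ge_1:
  assumes "q \<in> hurwitz" "q \<noteq> 0" shows "1 \<le> norm q"
proof (cases "\<forall>i. q$i \<in> \<int>")
  case True
  obtain i where "q$i \<noteq> 0" using assms(2) by (auto simp: vec_eq_iff)
  then have "1 \<le> \<bar>q$i\<bar>" using True Ints_nonzero_abs_ge1 by blast
  then show ?thesis using component_le_norm_cart[of q i] by linarith
next
  case False
  then have *: "q$i - 1/2 \<in> \<int>" for i using assms(1) by (auto simp: hurwitz_def)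
  have "1/4 \<le> (q$i)\<^sup>2" for i
  proof -
    obtain n :: int where n: "q$i - 1/2 = of_int n" using * Ints_cases by metis
    \<comment> \<open>No integer lies strictly between -1 and 0; completing the square then gives
      the bound 1/4.\<close>
    have "0 \<le> n * (n + 1)" by (cases "n \<ge> 0") (auto simp: mult_nonpos_nonpos)
    then have "(0::real) \<le> of_int n * (of_int n + 1)" by (metis of_int_0_le_iff of_int_1 of_int_add of_int_mult)
    moreover have "(q$i)\<^sup>2 = of_int n * (of_int n + 1) + 1/4"
    proof -
      have "q$i = of_int n + 1/2" using n by simp
      then show ?thesis by (simp only:) (simp add: power2_eq_square algebra_simps)
    qed
    ultimately show ?thesis by simp
  qed
  from this[of 1] this[of 2] this[of 3] this[of 4] have "1\<^sup>2 \<le> (norm q)\<^sup>2"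
    unfolding qnorm_sq by simp
  then show ?thesis by (rule power2_le_imp_le) simp
qed

lemma dist_hurwitz_ge_1:
  assumes "p \<in> hurwitz" "q \<in> hurwitz" "p \<noteq> q" shows "1 \<le> dist p q"
  using norm_hurwitz_ge_1[OF hurwitz_diff[OF assms(1,2)]] assms(3) by (simp add: dist_norm)

section \<open>Packing bounds\<close>

lemma content_cball_quat:
  "measure lebesgue (cball (x::quat) r) = unit_ball_vol 4 * r ^ 4" if "0 \<le> r"
  using content_cball[OF that, of x] by simp

lemma unit_ball_vol_4_pos: "0 < unit_ball_vol 4"
  by (rule unit_ball_vol_pos) simp

text \<open>The separation of the centres makes the open balls disjoint by the triangle inequality,
  so their volumes add up inside \<open>B\<close>.\<close>

lemma sum_pow4_disjoint_balls_le:
  fixes x :: "'i \<Rightarrow> quat"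
  assumes "finite A" "\<And>a. a \<in> A \<Longrightarrow> 0 \<le> \<rho> a"
    "\<And>a b. a \<in> A \<Longrightarrow> b \<in> A \<Longrightarrow> a \<noteq> b \<Longrightarrow> \<rho> a + \<rho> b \<le> dist (x a) (x b)"
    "\<And>a. a \<in> A \<Longrightarrow> ball (x a) (\<rho> a) \<subseteq> B" "B \<in> lmeasurable"
  shows "unit_ball_vol 4 * (\<Sum>a\<in>A. \<rho> a ^ 4) \<le> measure lebesgue B"
proof -
  have "unit_ball_vol 4 * (\<Sum>a\<in>A. \<rho> a ^ 4) = (\<Sum>a\<in>A. measure lebesgue (ball (x a) (\<rho> a)))"
    using assms(2) by (simp add: content_ball sum_distrib_left)
  also have "\<dots> = measure lebesgue (\<Union>a\<in>A. ball (x a) (\<rho> a))"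
  proof (rule measure_UNION_AE[symmetric, OF assms(1)])
    show "pairwise (\<lambda>a b. AE xa in lebesgue. xa \<notin> ball (x a) (\<rho> a) \<or> xa \<notin> ball (x b) (\<rho> b)) A"
    proof (rule pairwiseI, rule AE_I2)
      fix a b z assume "a \<in> A" "b \<in> A" "a \<noteq> b"
      then show "z \<notin> ball (x a) (\<rho> a) \<or> z \<notin> ball (x b) (\<rho> b)"
        using assms(3)[of a b] dist_triangle2[of "x a" "x b" z] by (auto simp: dist_commute)
    qed
  qed auto
  also have "\<dots> \<le> measure lebesgue B"
    using assms(1,4,5) by (intro measure_mono_fmeasurable UN_least sets.finite_UN) auto
  finally show ?thesis .
qed

lemma card_separated_le_measure:
  fixes A :: "quat set"
  assumes "finite A" "0 \<le> s" "\<And>a b. a \<in> A \<Longrightarrow> b \<in> A \<Longrightarrow> a \<noteq> b \<Longrightarrow> s \<le> dist a b"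
    "\<And>a. a \<in> A \<Longrightarrow> ball a (s/2) \<subseteq> B" "B \<in> lmeasurable"
  shows "unit_ball_vol 4 * (real (card A) * (s/2) ^ 4) \<le> measure lebesgue B"
  using sum_pow4_disjoint_balls_le[of A "\<lambda>_. s/2" "\<lambda>a. a" B] assms by simp

text \<open>Balls of radius \<open>s/2\<close> around the points are disjoint and fit into the ball
  of radius \<open>R + s/2\<close>; the bound is the ratio of the volumes.\<close>

lemma card_separated_le:
  fixes A :: "quat set"
  assumes "finite A" "0 < s" "\<And>a b. a \<in> A \<Longrightarrow> b \<in> A \<Longrightarrow> a \<noteq> b \<Longrightarrow> s \<le> dist a b"
    "A \<subseteq> cball x R"
  shows "real (card A) \<le> (2 * R / s + 1) ^ 4"
proof (cases "A = {}")
  case True then show ?thesis by simp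
next
  case False
  \<comment> \<open>A point of \<open>A\<close> is what shows \<open>R\<close> to be nonnegative,
    hence the separate case of the empty set.\<close>
  then obtain a where "dist x a \<le> R" using assms(4) by (meson ex_in_conv mem_cball subsetD)
  then have "0 \<le> R" using zero_le_dist[of x a] by linarith
  have "unit_ball_vol 4 * (real (card A) * (s/2) ^ 4) \<le> measure lebesgue (cball x (R + s/2))"
  proof (rule card_separated_le_measure)
    fix a assume "a \<in> A"
    then have "dist x a \<le> R" using assms(4) by auto
    then show "ball a (s/2) \<subseteq> cball x (R + s/2)"
      by (smt (verit) dist_triangle mem_ball mem_cball subsetI)
  qed (use assms in auto)
  also have "\<dots> = unit_ball_vol 4 * (R + s/2) ^ 4"
    using \<open>0 \<le> R\<close> assms(2) by (intro content_cball_quat) auto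
  finally have "real (card A) * (s/2) ^ 4 \<le> (R + s/2) ^ 4"
    using unit_ball_vol_4_pos by simp
  then have "real (card A) \<le> (R + s/2) ^ 4 / (s/2) ^ 4"
    using assms(2) by (simp add: field_simps)
  also have "\<dots> = (2 * R / s + 1) ^ 4"
  proof -
    have "(R + s/2) / (s/2) = 2 * R / s + 1" using assms(2) by (simp add: field_simps)
    then show ?thesis by (simp only: power_divide[symmetric])
  qed
  finally show ?thesis .
qed

text \<open>The bound of \<open>card_separated_le\<close> is uniform over all finite subsets, which
  an infinite set would violate.\<close>

lemma finite_separated:
  fixes A :: "quat set"
  assumes "0 < s" "\<And>a b. a \<in> A \<Longrightarrow> b \<in> A \<Longrightarrow> a \<noteq> b \<Longrightarrow> s \<le> dist a b" "A \<subseteq> cball x R"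
  shows "finite A"
proof (rule ccontr)
  assume inf: "infinite A"
  obtain n :: nat where n: "(2 * R / s + 1) ^ 4 < real n"
    using reals_Archimedean2 by blast
  obtain B where B: "B \<subseteq> A" "finite B" "card B = n"
    using infinite_arbitrarily_large[OF inf] by blast
  have "real (card B) \<le> (2 * R / s + 1) ^ 4"
    using B by (intro card_separated_le[of B s x R] assms(1) assms(2)) (use assms(3) in blast)+
  with n B show False by simp
qed

lemma finite_hurwitz_cball: "finite (hurwitz \<inter> cball x R)"
  by (rule finite_separated[of 1 _ x R]) (auto simp: dist_hurwitz_ge_1)

lemma card_hurwitz_cball: "real (card (hurwitz \<inter> cball x R)) \<le> (2 * R + 1) ^ 4"
  using card_separated_le[of "hurwitz \<inter> cball x R" 1 x R] finite_hurwitz_cball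
  by (auto simp: dist_hurwitz_ge_1)

text \<open>Comparing volumes in a thickened shell, rather than in a ball, yields
  \<open>m ^ 3\<close> instead of \<open>m ^ 4\<close>. Together with about \<open>m ^ 4\<close>
  numerators per denominator this is the source of the exponent 7.\<close>

lemma card_hurwitz_shell:
  assumes "1 \<le> m"
  shows "real (card {q \<in> hurwitz. nat \<lfloor>norm q\<rfloor> = m}) \<le> 1600 * real m ^ 3"
proof -
  let ?A = "{q \<in> hurwitz. nat \<lfloor>norm q\<rfloor> = m}"
  have nq: "real m \<le> norm q" "norm q < real m + 1" if "q \<in> ?A" for q
  proof -
    have "\<lfloor>norm q\<rfloor> = int m" using that assms by auto
    then show "real m \<le> norm q" "norm q < real m + 1" by linarith+
  qed
  have fin: "finite ?A"
    by (rule finite_subset[OF _ finite_hurwitz_cball[of 0 "real m + 1"]]) (use nq in force)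
  \<comment> \<open>Balls of radius 1/2 about points with norm in \<open>[m, m + 1)\<close> stay in
    this shell.\<close>
  let ?B = "cball 0 (real m + 3/2) - ball (0::quat) (real m - 1/2)"
  have "unit_ball_vol 4 * (real (card ?A) * (1/2) ^ 4) \<le> measure lebesgue ?B"
  proof (rule card_separated_le_measure[OF fin])
    fix a assume a: "a \<in> ?A"
    show "ball a (1 / 2) \<subseteq> ?B"
    proof
      fix z assume "z \<in> ball a (1/2)"
      then have "norm (z - a) < 1/2" by (simp add: dist_norm norm_minus_commute)
      then have "norm z < norm a + 1/2" "norm a - 1/2 < norm z"
        using norm_triangle_ineq2[of z a] norm_triangle_ineq3[of z a] by linarith+
      with nq[OF a] show "z \<in> ?B" by simp
    qed
  qed (auto simp: dist_hurwitz_ge_1 fmeasurable_Diff)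
  also have "measure lebesgue ?B = measure lebesgue (cball (0::quat) (real m + 3/2)) - measure lebesgue (ball (0::quat) (real m - 1/2))"
    using assms by (intro measurable_measure_Diff) auto
  also have "\<dots> = unit_ball_vol 4 * ((real m + 3/2) ^ 4 - (real m - 1/2) ^ 4)"
    using assms by (simp add: content_ball content_cball right_diff_distrib)
  finally have "real (card ?A) * (1/2) ^ 4 \<le> (real m + 3/2) ^ 4 - (real m - 1/2) ^ 4"
    using unit_ball_vol_4_pos mult_le_cancel_left_pos by blast
  also have "\<dots> = 8 * real m ^ 3 + 12 * real m ^ 2 + 14 * real m + 5"
    by (simp add: field_simps eval_nat_numeral)
  also have "\<dots> \<le> 8 * real m ^ 3 + 12 * real m ^ 3 + 14 * real m ^ 3 + 5 * real m ^ 3"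
  proof -
    have "real m ^ 2 \<le> real m ^ 3" "real m ^ 1 \<le> real m ^ 3" "1 \<le> real m ^ 3"
      by (rule power_increasing; use assms in simp)+ (use assms in simp)
    then show ?thesis unfolding power_one_right by linarith
  qed
  also have "\<dots> \<le> 100 * real m ^ 3" by simp
  finally show ?thesis by (simp add: power_one_over)
qed


section \<open>Hausdorff measures\<close>

lemma dimension_function_mono:
  "dimension_function f \<Longrightarrow> 0 \<le> x \<Longrightarrow> x \<le> y \<Longrightarrow> f x \<le> f y"
  by (auto simp: dimension_function_def mono_on_def)

lemma dimension_function_nonneg: "dimension_function f \<Longrightarrow> 0 \<le> x \<Longrightarrow> 0 \<le> f x"
  by (auto simp: dimension_function_def)

lemma dimension_function_pos: "dimension_function f \<Longrightarrow> 0 < x \<Longrightarrow> 0 < f x"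
  by (auto simp: dimension_function_def)

lemma hausdorff_pre_mono: "E \<subseteq> F \<Longrightarrow> hausdorff_pre f \<epsilon> E \<le> hausdorff_pre f \<epsilon> F"
  unfolding hausdorff_pre_def by (intro INF_superset_mono) auto

lemma hausdorff_measure_mono: "E \<subseteq> F \<Longrightarrow> hausdorff_measure f E \<le> hausdorff_measure f F"
  unfolding hausdorff_measure_SUP by (intro SUP_mono) (auto intro: hausdorff_pre_mono)

text \<open>Covers of the \<open>E n\<close> that are optimal up to \<open>e / 2 ^ (n + 1)\<close>
  are merged into one sequence; the errors add up to \<open>e\<close>.\<close>

lemma hausdorff_pre_UN_le:
  fixes E :: "nat \<Rightarrow> 'a::metric_space set"
  shows "hausdorff_pre f \<epsilon> (\<Union>n. E n) \<le> (\<Sum>n. hausdorff_pre f \<epsilon> (E n))"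
proof (rule ennreal_le_epsilon)
  fix e :: real assume fin: "(\<Sum>n. hausdorff_pre f \<epsilon> (E n)) < top" and "0 < e"
  define S where "S C \<longleftrightarrow> (\<forall>i::nat. bounded (C i) \<and> diameter (C i :: 'a set) \<le> \<epsilon>)" for C
  have "\<exists>C. E n \<subseteq> (\<Union>i. C i) \<and> S C \<and>
     (\<Sum>i. ennreal (f (diameter (C i)))) \<le> hausdorff_pre f \<epsilon> (E n) + ennreal (e * (1/2) ^ Suc n)" for n
  proof -
    \<comment> \<open>Finiteness makes the addition of a positive amount strict, so that some cover
      stays below the enlarged value.\<close>
    have "hausdorff_pre f \<epsilon> (E n) < top"
      using ennreal_suminf_lessD[OF fin] by simp
    then have "hausdorff_pre f \<epsilon> (E n) < hausdorff_pre f \<epsilon> (E n) + ennreal (e * (1/2) ^ Suc n)"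
      using \<open>0 < e\<close> by (simp add: ennreal_add_left_cancel_less[where b=0, simplified] less_top)
    then show ?thesis
      unfolding hausdorff_pre_def[of f \<epsilon> "E n"] INF_less_iff S_def by (auto intro: less_imp_le)
  qed
  then obtain C where C: "\<And>n. E n \<subseteq> (\<Union>i. C n i)" "\<And>n. S (C n)"
    "\<And>n. (\<Sum>i. ennreal (f (diameter (C n i)))) \<le> hausdorff_pre f \<epsilon> (E n) + ennreal (e * (1/2) ^ Suc n)"
    by metis
  \<comment> \<open>The pairing function turns the doubly indexed covers into a single
    sequence.\<close>
  define D where "D k = (case prod_decode k of (n, i) \<Rightarrow> C n i)" for k
  have D: "D (prod_encode (n, i)) = C n i" for n i by (simp add: D_def)
  have "(\<Union>n. E n) \<subseteq> (\<Union>k. D k)"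
  proof
    fix x assume "x \<in> (\<Union>n. E n)"
    then obtain n i where "x \<in> C n i" using C(1) by blast
    then show "x \<in> (\<Union>k. D k)" using D by blast
  qed
  moreover have "S D" using C(2) by (auto simp: S_def D_def split: prod.split)
  ultimately have "hausdorff_pre f \<epsilon> (\<Union>n. E n) \<le> (\<Sum>k. ennreal (f (diameter (D k))))"
    unfolding hausdorff_pre_def by (intro INF_lower) (auto simp: S_def)
  also have "\<dots> = (\<Sum>n. \<Sum>i. ennreal (f (diameter (C n i))))"
    using suminf_ennreal_2dimen[of "\<lambda>n. \<Sum>i. ennreal (f (diameter (C n i)))"
        "\<lambda>p. ennreal (f (diameter (C (fst p) (snd p))))"]
    by (simp add: D_def case_prod_unfold comp_def)
  also have "\<dots> \<le> (\<Sum>n. hausdorff_pre f \<epsilon> (E n) + ennreal (e * (1/2) ^ Suc n))"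
    by (intro suminf_le C(3)) auto
  also have "\<dots> = (\<Sum>n. hausdorff_pre f \<epsilon> (E n)) + (\<Sum>n. ennreal (e * (1/2) ^ Suc n))"
    by (intro suminf_add[symmetric]) auto
  also have "(\<Sum>n. ennreal (e * (1/2) ^ Suc n)) = ennreal e"
  proof (rule suminf_ennreal_eq)
    show "(\<lambda>n. e * (1/2) ^ Suc n) sums e"
      using sums_mult[OF power_half_series, of e] by simp
  qed (use \<open>0 < e\<close> in auto)
  finally show "hausdorff_pre f \<epsilon> (\<Union>n. E n) \<le> (\<Sum>n. hausdorff_pre f \<epsilon> (E n)) + ennreal e" .
qed

text \<open>The cover is \<open>E\<close> followed by empty sets, and \<open>f 0 = 0\<close> makes
  this padding free.\<close>

lemma hausdorff_pre_le_diameter: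
  assumes "f 0 = 0" "bounded E" "diameter E \<le> \<epsilon>" "0 \<le> \<epsilon>"
  shows "hausdorff_pre f \<epsilon> E \<le> ennreal (f (diameter E))"
proof -
  let ?C = "\<lambda>i::nat. if i = 0 then E else {}"
  have "hausdorff_pre f \<epsilon> E \<le> (\<Sum>i. ennreal (f (diameter (?C i))))"
    unfolding hausdorff_pre_def by (intro INF_lower) (use assms in auto)
  also have "\<dots> = (\<Sum>i\<in>{0}. ennreal (f (diameter (?C i))))"
    by (intro suminf_finite) (use assms(1) in auto)
  finally show ?thesis by simp
qed

lemma hausdorff_pre_Un_le:
  assumes "f 0 = 0" "0 \<le> \<epsilon>"
  shows "hausdorff_pre f \<epsilon> (A \<union> B) \<le> hausdorff_pre f \<epsilon> A + hausdorff_pre f \<epsilon> B"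
proof -
  let ?E = "\<lambda>n::nat. if n = 0 then A else if n = 1 then B else {}"
  have e: "hausdorff_pre f \<epsilon> {} = 0"
    using hausdorff_pre_le_diameter[of f "{}" \<epsilon>] assms by simp
  have "A \<union> B = (\<Union>n. ?E n)" by (auto split: if_splits)
  then have "hausdorff_pre f \<epsilon> (A \<union> B) \<le> (\<Sum>n. hausdorff_pre f \<epsilon> (?E n))"
    using hausdorff_pre_UN_le[of f \<epsilon> ?E] by simp
  also have "\<dots> = (\<Sum>n\<in>{0,1}. hausdorff_pre f \<epsilon> (?E n))"
    by (intro suminf_finite) (auto simp: e)
  finally show ?thesis by simp
qed

lemma hausdorff_pre_UN_finite_le:
  assumes "f 0 = 0" "0 \<le> \<epsilon>" "finite I"
  shows "hausdorff_pre f \<epsilon> (\<Union>i\<in>I. A i) \<le> (\<Sum>i\<in>I. hausdorff_pre f \<epsilon> (A i))"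
  using assms(3)
proof induction
  case empty
  then show ?case using hausdorff_pre_le_diameter[of f "{}" \<epsilon>] assms by simp
next
  case (insert i I)
  have "hausdorff_pre f \<epsilon> (\<Union>i\<in>insert i I. A i) \<le> hausdorff_pre f \<epsilon> (A i) + hausdorff_pre f \<epsilon> (\<Union>i\<in>I. A i)"
    using hausdorff_pre_Un_le[of f, OF assms(1,2)] by simp
  also have "\<dots> \<le> hausdorff_pre f \<epsilon> (A i) + (\<Sum>i\<in>I. hausdorff_pre f \<epsilon> (A i))"
    by (intro add_left_mono insert)
  finally show ?case using insert by simp
qed

section \<open>The convergence case\<close>

text \<open>\<open>\<Psi>\<close> converges and is therefore bounded. With denominators of bounded
  norm, only numerators of bounded norm, hence finitely many, come near \<open>\<xi>\<close>; an
  infinite solution set thus contains arbitrarily large denominators.\<close>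

lemma approximable_exists_large:
  assumes "approximation_function \<Psi>" "\<xi> \<in> approximable \<Psi>"
  obtains p q where "p \<in> hurwitz" "q \<in> hurwitz" "q \<noteq> 0" "norm (\<xi> - p \<odot> qinv q) < \<Psi> (nat \<lfloor>norm q\<rfloor>)"
    "M \<le> nat \<lfloor>norm q\<rfloor>"
proof (rule ccontr)
  assume neg: "\<not> thesis"
  let ?P = "{(p, q). p \<in> hurwitz \<and> q \<in> hurwitz \<and> q \<noteq> 0 \<and> norm (\<xi> - p \<odot> qinv q) < \<Psi> (nat \<lfloor>norm q\<rfloor>)}"
  have "Bseq \<Psi>"
    using assms(1) convergentI convergent_imp_Bseq by (auto simp: approximation_function_def)
  then obtain K where K: "\<And>n. norm (\<Psi> n) \<le> K" "0 < K" by (meson BseqE)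
  have "?P \<subseteq> (hurwitz \<inter> cball 0 ((norm \<xi> + K) * (M + 1))) \<times> (hurwitz \<inter> cball 0 (M + 1))"
  proof
    fix z assume "z \<in> ?P"
    then obtain p q where z: "z = (p, q)" and pq: "p \<in> hurwitz" "q \<in> hurwitz" "q \<noteq> 0"
        "norm (\<xi> - p \<odot> qinv q) < \<Psi> (nat \<lfloor>norm q\<rfloor>)" by auto
    then have "nat \<lfloor>norm q\<rfloor> < M" using neg that by (meson not_le)
    then have q: "norm q \<le> M + 1" by linarith
    have "norm p / norm q \<le> norm \<xi> + K"
      using norm_triangle_ineq2[of "p \<odot> qinv q" \<xi>] pq(4) K(1)[of "nat \<lfloor>norm q\<rfloor>"]
      by (simp add: norm_fraction norm_minus_commute)
    then have "norm p \<le> (norm \<xi> + K) * norm q" using pq(3) by (simp add: field_simps)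
    also have "\<dots> \<le> (norm \<xi> + K) * (M + 1)" using q K(2) by (intro mult_left_mono) auto
    finally show "z \<in> (hurwitz \<inter> cball 0 ((norm \<xi> + K) * (M + 1))) \<times> (hurwitz \<inter> cball 0 (M + 1))"
      using z pq q by simp
  qed
  then have "finite ?P"
    using finite_hurwitz_cball by (meson finite_SigmaI finite_subset)
  with assms(2) show False by (simp add: approximable_def)
qed

text \<open>The doubling condition: it absorbs the passage from radius to diameter in the
  convergence case and the halved radius in the divergence case.\<close>

lemma dimension_double_le:
  assumes "dimension_function f" "antimono_on {0<..} (\<lambda>x. f x / x ^ 4)" "0 < x"
  shows "f (2 * x) \<le> 16 * f x"
proof -
  have "f (2 * x) / (2 * x) ^ 4 \<le> f x / x ^ 4"
    using assms(3) by (intro monotone_onD[OF assms(2)]) auto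
  then show ?thesis using assms(3) by (simp add: field_simps power_mult_distrib)
qed

text \<open>There are \<open>O(m ^ 3)\<close> denominators with \<open>O(m ^ 4)\<close> numerators
  for each, and a ball of diameter \<open>2 * \<psi>\<close> costs at most
  \<open>16 * f \<psi>\<close>; 25600 is 16 times 1600. The bound \<open>R + 1\<close> admits all
  centres at distance at most 1 from the ball of radius \<open>R\<close>.\<close>

lemma approximable_level_pre_le:
  assumes f: "dimension_function f" "antimono_on {0<..} (\<lambda>x. f x / x ^ 4)"
    and m: "1 \<le> m" and R: "0 \<le> R" and \<psi>: "0 < \<psi>" "\<psi> \<le> 1" "2 * \<psi> \<le> \<epsilon>"
  defines "P \<equiv> {(p, q). p \<in> hurwitz \<and> q \<in> hurwitz \<and> nat \<lfloor>norm q\<rfloor> = m \<and> norm (p \<odot> qinv q) \<le> R + 1}"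
  shows "hausdorff_pre f \<epsilon> (\<Union>(p, q)\<in>P. cball (p \<odot> qinv q) \<psi>)
    \<le> ennreal (25600 * (4 * (R + 1) + 1) ^ 4 * (real m ^ 7 * f \<psi>))"
proof -
  let ?Q = "{q \<in> hurwitz. nat \<lfloor>norm q\<rfloor> = m}"
  let ?B = "hurwitz \<inter> cball 0 ((R + 1) * (2 * real m))"
  have finQ: "finite ?Q"
  proof (rule finite_subset[OF _ finite_hurwitz_cball[of 0 "real m + 1"]], rule subsetI)
    fix q assume q: "q \<in> ?Q"
    have "norm q \<le> real (nat \<lfloor>norm q\<rfloor>) + 1" by linarith
    with q show "q \<in> hurwitz \<inter> cball 0 (real m + 1)" by simp
  qed
  have sub: "P \<subseteq> ?B \<times> ?Q"
  proof
    fix z assume "z \<in> P"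
    then obtain p q where z: "z = (p, q)" "p \<in> hurwitz" "q \<in> hurwitz"
      and a: "norm (p \<odot> qinv q) \<le> R + 1" "nat \<lfloor>norm q\<rfloor> = m" by (auto simp: P_def)
    then have q: "real m \<le> norm q" "norm q < real m + 1" using m by linarith+
    then have "0 < norm q" using m by linarith
    then have "norm p \<le> (R + 1) * norm q" using a by (simp add: norm_fraction field_simps)
    also have "\<dots> \<le> (R + 1) * (2 * real m)" using q R m by (intro mult_left_mono) auto
    finally show "z \<in> ?B \<times> ?Q" using a z by simp
  qed
  have finP: "finite P" using finQ finite_hurwitz_cball finite_subset[OF sub] by blast
  have "card P \<le> card (?B \<times> ?Q)"
    using finQ finite_hurwitz_cball by (intro card_mono sub finite_cartesian_product)
  then have "real (card P) \<le> real (card ?B) * real (card ?Q)"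
    by (simp only: card_cartesian_product of_nat_mult[symmetric] of_nat_le_iff)
  also have "\<dots> \<le> (2 * ((R + 1) * (2 * real m)) + 1) ^ 4 * (1600 * real m ^ 3)"
    using m by (intro mult_mono card_hurwitz_cball card_hurwitz_shell) auto
  also have "\<dots> \<le> ((4 * (R + 1) + 1) * real m) ^ 4 * (1600 * real m ^ 3)"
    using m R by (intro mult_right_mono power_mono) (auto simp: algebra_simps)
  also have "\<dots> = 1600 * (4 * (R + 1) + 1) ^ 4 * real m ^ 7"
    by (simp add: power_mult_distrib eval_nat_numeral)
  finally have card: "real (card P) \<le> 1600 * (4 * (R + 1) + 1) ^ 4 * real m ^ 7" .
  have f0: "f 0 = 0" using f(1) by (rule dimension_function_0)
  have "hausdorff_pre f \<epsilon> (cball (p \<odot> qinv q) \<psi>) \<le> ennreal (16 * f \<psi>)" for p q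
  proof -
    have "hausdorff_pre f \<epsilon> (cball (p \<odot> qinv q) \<psi>) \<le> ennreal (f (2 * \<psi>))"
      using hausdorff_pre_le_diameter[of f "cball (p \<odot> qinv q) \<psi>" \<epsilon>] f0 \<psi> by simp
    also have "\<dots> \<le> ennreal (16 * f \<psi>)"
      by (intro ennreal_leI dimension_double_le f \<psi>)
    finally show ?thesis .
  qed
  then have "(\<Sum>(p, q)\<in>P. hausdorff_pre f \<epsilon> (cball (p \<odot> qinv q) \<psi>)) \<le> (\<Sum>(p, q)\<in>P. ennreal (16 * f \<psi>))"
    by (intro sum_mono) auto
  also have "\<dots> = ennreal (real (card P) * (16 * f \<psi>))"
    using dimension_function_nonneg[OF f(1), of \<psi>] \<psi> by (simp add: ennreal_mult ennreal_of_nat_eq_real_of_nat)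
  also have "\<dots> \<le> ennreal (25600 * (4 * (R + 1) + 1) ^ 4 * (real m ^ 7 * f \<psi>))"
    using mult_right_mono[OF card, of "16 * f \<psi>"] dimension_function_nonneg[OF f(1), of \<psi>] \<psi>
    by (intro ennreal_leI) (simp add: algebra_simps)
  finally have "(\<Sum>z\<in>P. hausdorff_pre f \<epsilon> (case z of (p, q) \<Rightarrow> cball (p \<odot> qinv q) \<psi>))
      \<le> ennreal (25600 * (4 * (R + 1) + 1) ^ 4 * (real m ^ 7 * f \<psi>))" by (simp add: case_prod_unfold)
  then show ?thesis
    using hausdorff_pre_UN_finite_le[where f=f, OF f0 _ finP, of \<epsilon> "\<lambda>(p, q). cball (p \<odot> qinv q) \<psi>"] \<psi>
    by (meson order_trans less_imp_le mult_pos_pos zero_less_numeral)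
qed

text \<open>A Borel-Cantelli argument: the fractions with denominators beyond any bound
  \<open>M\<close> still cover each bounded piece, at a cost proportional to a tail of the
  series.\<close>

lemma hausdorff_measure_approximable_eq_0:
  assumes f: "dimension_function f" "antimono_on {0<..} (\<lambda>x. f x / x ^ 4)"
    and \<Psi>: "approximation_function \<Psi>"
    and conv: "(\<Sum>m. ennreal (real (Suc m) ^ 7 * f (\<Psi> (Suc m)))) < \<infinity>"
  shows "hausdorff_measure f (approximable \<Psi>) = 0"
proof -
  define a where "a m = real (Suc m) ^ 7 * f (\<Psi> (Suc m))" for m
  have pos: "0 < \<Psi> (Suc m)" for m using \<Psi> by (auto simp: approximation_function_def)
  have a0: "0 \<le> a m" for m
    unfolding a_def using pos by (intro mult_nonneg_nonneg dimension_function_nonneg[OF f(1)]) (auto intro: less_imp_le)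
  have summ: "summable a"
    using conv a0 unfolding a_def[symmetric] by (intro summable_suminf_not_top) auto
  \<comment> \<open>Only in a bounded piece is the number of relevant fractions finite. The constant
    \<open>c\<close> depends on \<open>n\<close> but not on \<open>M\<close>, and the pieces are
    reassembled by countable subadditivity.\<close>
  have "hausdorff_pre f \<epsilon> (approximable \<Psi> \<inter> cball 0 (real n)) = 0" if \<epsilon>: "0 < \<epsilon>" for \<epsilon> n
  proof -
    define c where "c = 25600 * (4 * (real n + 1) + 1) ^ 4"
    have "0 \<le> c" by (simp add: c_def)
    have "\<exists>M0. \<forall>m\<ge>M0. \<Psi> m < min 1 (\<epsilon>/2)"
      using \<Psi> \<epsilon> order_tendstoD(2)[of \<Psi> 0 sequentially "min 1 (\<epsilon>/2)"]
      by (auto simp: approximation_function_def eventually_sequentially)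
    then obtain M0 where M0: "\<And>m. m \<ge> M0 \<Longrightarrow> \<Psi> m < min 1 (\<epsilon>/2)" by blast
    have *: "hausdorff_pre f \<epsilon> (approximable \<Psi> \<inter> cball 0 (real n)) \<le> ennreal (c * (\<Sum>i. a (i + M)))"
      if "M \<ge> M0" for M
    proof -
      \<comment> \<open>Denominators of size \<open>Suc (i + M)\<close> correspond to the term
        \<open>a (i + M)\<close>, because \<open>a 0\<close> belongs to size 1.\<close>
      define E where "E i = (\<Union>(p, q)\<in>{(p, q). p \<in> hurwitz \<and> q \<in> hurwitz \<and> nat \<lfloor>norm q\<rfloor> = Suc (i + M)
          \<and> norm (p \<odot> qinv q) \<le> real n + 1}. cball (p \<odot> qinv q) (\<Psi> (Suc (i + M))))" for i
      have "approximable \<Psi> \<inter> cball 0 (real n) \<subseteq> (\<Union>i. E i)"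
      proof
        fix \<xi> assume \<xi>: "\<xi> \<in> approximable \<Psi> \<inter> cball 0 (real n)"
        then obtain p q where pq: "p \<in> hurwitz" "q \<in> hurwitz" "q \<noteq> 0"
          "norm (\<xi> - p \<odot> qinv q) < \<Psi> (nat \<lfloor>norm q\<rfloor>)" "Suc M \<le> nat \<lfloor>norm q\<rfloor>"
          using approximable_exists_large[OF \<Psi>, of \<xi> "Suc M"] by blast
        obtain i where i: "nat \<lfloor>norm q\<rfloor> = Suc (i + M)"
          using pq(5) by (metis Suc_le_D Suc_le_mono le_add_diff_inverse2)
        have "\<Psi> (Suc (i + M)) < 1" using M0[of "Suc (i + M)"] that by simp
        then have "norm (p \<odot> qinv q) \<le> real n + 1"
          using \<xi> pq(4) i norm_triangle_ineq2[of "p \<odot> qinv q" \<xi>] by (simp add: norm_minus_commute)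
        moreover have "\<xi> \<in> cball (p \<odot> qinv q) (\<Psi> (Suc (i + M)))"
          using pq(4) i by (simp add: dist_norm norm_minus_commute)
        ultimately have "\<xi> \<in> E i" unfolding E_def using pq i by auto
        then show "\<xi> \<in> (\<Union>i. E i)" by blast
      qed
      then have "hausdorff_pre f \<epsilon> (approximable \<Psi> \<inter> cball 0 (real n)) \<le> hausdorff_pre f \<epsilon> (\<Union>i. E i)"
        by (rule hausdorff_pre_mono)
      also have "\<dots> \<le> (\<Sum>i. hausdorff_pre f \<epsilon> (E i))" by (rule hausdorff_pre_UN_le)
      also have "\<dots> \<le> (\<Sum>i. ennreal (c * a (i + M)))"
      proof (intro suminf_le)
        fix i
        show "hausdorff_pre f \<epsilon> (E i) \<le> ennreal (c * a (i + M))"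
          unfolding E_def c_def a_def
          by (rule approximable_level_pre_le[OF f]) (use pos[of "i + M"] M0[of "Suc (i + M)"] that in auto)
      qed auto
      also have "\<dots> = ennreal (c * (\<Sum>i. a (i + M)))"
        using summ a0 \<open>0 \<le> c\<close>
        by (subst suminf_ennreal2) (auto intro!: summable_mult simp: suminf_mult summable_iff_shift)
      finally show ?thesis .
    qed
    have "(\<lambda>M. ennreal (c * (\<Sum>i. a (i + M)))) \<longlonglongrightarrow> ennreal (c * 0)"
      by (intro tendsto_ennrealI tendsto_mult tendsto_const suminf_exist_split2 summ)
    then have "hausdorff_pre f \<epsilon> (approximable \<Psi> \<inter> cball 0 (real n)) \<le> ennreal (c * 0)"
      by (rule LIMSEQ_le_const) (use * in blast)
    then show ?thesis by simp
  qed
  then have "hausdorff_pre f \<epsilon> (\<Union>n. approximable \<Psi> \<inter> cball 0 (real n)) = 0" if "0 < \<epsilon>" for \<epsilon>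
    using hausdorff_pre_UN_le[of f \<epsilon> "\<lambda>n. approximable \<Psi> \<inter> cball 0 (real n)"] that by simp
  moreover have "(\<Union>n. approximable \<Psi> \<inter> cball 0 (real n)) = approximable \<Psi>"
    using real_arch_simple by auto
  ultimately show ?thesis unfolding hausdorff_measure_SUP by simp
qed


section \<open>Rational quaternions are ubiquitous\<close>

text \<open>These are the Lipschitz integers. The pigeonhole proof of Dirichlet's theorem produces
  integral components, so the divergence case works with this subring.\<close>

definition lipschitz :: "quat set" where
  "lipschitz = {q. \<forall>i. q$i \<in> \<int>}"

lemma lipschitz_subset_hurwitz: "lipschitz \<subseteq> hurwitz"
  by (auto simp: lipschitz_def hurwitz_def)

section \<open>Dirichlet's theorem for quaternions and ubiquity\<close>

lemma norm_quat_le_componentwise: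
  assumes "\<And>i. \<bar>(x::quat)$i\<bar> \<le> c" shows "norm x \<le> 2 * c"
proof -
  have c: "0 \<le> c" using assms[of 1] by linarith
  have "(x$i)\<^sup>2 \<le> c\<^sup>2" for i using assms[of i] c by (simp add: abs_le_square_iff[symmetric])
  from this[of 1] this[of 2] this[of 3] this[of 4] have "(norm x)\<^sup>2 \<le> (2 * c)\<^sup>2"
    unfolding qnorm_sq by (simp add: power_mult_distrib)
  then show ?thesis by (rule power2_le_imp_le) (use c in simp)
qed

text \<open>Pigeonhole principle: \<open>(N + 1) ^ 4\<close> integral quaternions compete for
  \<open>N ^ 4\<close> boxes of fractional parts. Two in the same box have a difference
  \<open>q\<close> for which \<open>\<xi> \<odot> q\<close> is within \<open>1 / N\<close> of an
  integer in each component.\<close>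

lemma dirichlet_quat:
  fixes \<xi> :: quat and N :: nat
  assumes "1 \<le> N"
  obtains p q where "p \<in> lipschitz" "q \<in> lipschitz" "q \<noteq> 0" "norm q \<le> 2 * real N"
    "norm (\<xi> \<odot> q - p) \<le> 2 / real N"
proof -
  define v :: "(4 \<Rightarrow> nat) \<Rightarrow> quat" where "v a = (\<chi> i. real (a i))" for a
  \<comment> \<open>\<open>F a\<close> names the box of side \<open>1 / N\<close> that contains the
    fractional parts of the components of \<open>\<xi> \<odot> v a\<close>.\<close>
  define F where "F a = (\<lambda>i. nat \<lfloor>real N * frac ((\<xi> \<odot> v a)$i)\<rfloor>)" for a
  let ?A = "(UNIV::4 set) \<rightarrow>\<^sub>E {0..N}" and ?B = "(UNIV::4 set) \<rightarrow>\<^sub>E {..<N}"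
  have "F ` ?A \<subseteq> ?B"
  proof (rule image_subsetI)
    fix a assume "a \<in> ?A"
    have "nat \<lfloor>real N * frac x\<rfloor> < N" for x :: real
    proof -
      have "real N * frac x < real N * 1" using assms frac_lt_1[of x] by (intro mult_strict_left_mono) auto
      then show ?thesis using assms by (simp add: nat_less_iff floor_less_iff)
    qed
    then show "F a \<in> ?B" by (auto simp: F_def)
  qed
  then have "card (F ` ?A) \<le> card ?B" by (intro card_mono finite_PiE) auto
  also have "\<dots> < card ?A" by (simp add: card_PiE power_strict_mono)
  finally have "\<not> inj_on F ?A" by (rule pigeonhole)
  then obtain a b where ab: "a \<in> ?A" "b \<in> ?A" "a \<noteq> b" "F a = F b"
    by (auto simp: inj_on_def)
  define q where "q = v a - v b"
  define p :: quat where "p = (\<chi> i. of_int \<lfloor>(\<xi> \<odot> v a)$i\<rfloor> - of_int \<lfloor>(\<xi> \<odot> v b)$i\<rfloor>)"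
  show thesis
  proof
    show "p \<in> lipschitz" "q \<in> lipschitz" by (auto simp: lipschitz_def p_def q_def v_def)
    show "q \<noteq> 0" using ab(3) by (auto simp: q_def v_def vec_eq_iff fun_eq_iff)
    have "\<bar>q$i\<bar> \<le> real N" for i
      using PiE_mem[OF ab(1), of i] PiE_mem[OF ab(2), of i] by (auto simp: q_def v_def)
    then show "norm q \<le> 2 * real N" by (rule norm_quat_le_componentwise)
    have "\<bar>(\<xi> \<odot> q - p)$i\<bar> \<le> 1 / real N" for i
    proof -
      let ?x = "frac ((\<xi> \<odot> v a)$i)" and ?y = "frac ((\<xi> \<odot> v b)$i)"
      have "nat \<lfloor>real N * ?x\<rfloor> = nat \<lfloor>real N * ?y\<rfloor>"
        using ab(4) by (auto simp: F_def fun_eq_iff)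
      moreover have "0 \<le> real N * ?x" "0 \<le> real N * ?y" by simp_all
      ultimately have "\<lfloor>real N * ?x\<rfloor> = \<lfloor>real N * ?y\<rfloor>" by (simp add: nat_eq_iff)
      then have "\<bar>real N * ?x - real N * ?y\<bar> \<le> 1" by linarith
      then have "real N * \<bar>?x - ?y\<bar> \<le> 1" by (simp add: right_diff_distrib[symmetric] abs_mult)
      moreover have "(\<xi> \<odot> q - p)$i = ?x - ?y"
        by (simp add: q_def qmult_diff_left p_def frac_def)
      ultimately have "real N * \<bar>(\<xi> \<odot> q - p)$i\<bar> \<le> 1" by metis
      then show ?thesis using assms by (simp add: pos_le_divide_eq mult.commute)
    qed
    then have "norm (\<xi> \<odot> q - p) \<le> 2 * (1 / real N)" by (rule norm_quat_le_componentwise)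
    then show "norm (\<xi> \<odot> q - p) \<le> 2 / real N" by simp
  qed
qed

text \<open>
  The lower bound on the norm of the denominator makes every Dirichlet approximation in the level
  one of quality of order \<open>N\<^sup>-\<^sup>2\<close>, and makes the denominators of distant levels distinct.
\<close>

definition level :: "nat \<Rightarrow> quat set" where
  "level N = {p \<odot> qinv q | p q. p \<in> lipschitz \<and> q \<in> lipschitz \<and> real N / 64 < norm q \<and> norm q \<le> 2 * real N}"

lemma finite_lipschitz_cball: "finite (lipschitz \<inter> cball x R)"
  by (rule finite_subset[OF _ finite_hurwitz_cball[of x R]]) (use lipschitz_subset_hurwitz in blast)

lemma card_lipschitz_cball: "real (card (lipschitz \<inter> cball x R)) \<le> (2 * R + 1) ^ 4"
proof -
  have "card (lipschitz \<inter> cball x R) \<le> card (hurwitz \<inter> cball x R)"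
    by (intro card_mono finite_hurwitz_cball) (use lipschitz_subset_hurwitz in blast)
  then show ?thesis using card_hurwitz_cball[of x R] by linarith
qed

lemma measure_UN_cball_le:
  fixes c :: "'i \<Rightarrow> quat"
  assumes "finite I" "0 \<le> \<rho>"
  shows "measure lebesgue (\<Union>i\<in>I. cball (c i) \<rho>) \<le> unit_ball_vol 4 * (real (card I) * \<rho> ^ 4)"
proof -
  have "measure lebesgue (\<Union>i\<in>I. cball (c i) \<rho>) \<le> (\<Sum>i\<in>I. measure lebesgue (cball (c i) \<rho>))"
    using assms(1) by (intro measure_UNION_le) auto
  also have "\<dots> = unit_ball_vol 4 * (real (card I) * \<rho> ^ 4)"
    using assms(2) by (simp add: content_cball)
  finally show ?thesis .
qed

text \<open>\<open>S\<close> collects the points near fractions whose denominators have norm at most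
  \<open>N / 64\<close>; a union bound shows that it has at most half the volume of the ball. Every
  other point of the ball has a Dirichlet denominator of larger norm and so lies close to the
  level.\<close>

lemma ubiquity:
  fixes x0 :: quat
  assumes h: "0 < h"
  shows "\<forall>\<^sub>F N in sequentially. \<exists>S \<in> lmeasurable. measure lebesgue S \<le> unit_ball_vol 4 * (h ^ 4 / 2) \<and>
    ball x0 h \<subseteq> S \<union> (\<Union>x\<in>level N. cball x (128 / (real N)\<^sup>2))"
proof -
  \<comment> \<open>Beyond norm \<open>L\<close> the term \<open>5 / norm q\<close> is at most
    \<open>h\<close>. The finitely many shorter denominators contribute at most \<open>K\<close>, a
    constant that is negligible against \<open>real N ^ 4\<close>.\<close>
  define L where "L = 5 / h"
  define K where "K = real (card (lipschitz \<inter> cball 0 L)) * (2 * h + 5) ^ 4"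
  have K0: "0 \<le> K" using h by (simp add: K_def)
  \<comment> \<open>The bound 32 gives \<open>2 * (N / 64) + 1 \<le> N / 16\<close> in the count of
    denominators; the other bound on \<open>N\<close> keeps the contribution of \<open>K\<close>
    below \<open>h ^ 4 / 4\<close>.\<close>
  have *: "\<exists>S \<in> lmeasurable. measure lebesgue S \<le> unit_ball_vol 4 * (h ^ 4 / 2) \<and>
    ball x0 h \<subseteq> S \<union> (\<Union>x\<in>level N. cball x (128 / (real N)\<^sup>2))"
    if N: "N \<ge> 32" "64 * K / h ^ 4 \<le> real N" for N
  proof -
    have N1: "1 \<le> real N" using N by simp
    define Q where "Q = {q \<in> lipschitz. q \<noteq> 0 \<and> norm q \<le> real N / 64}"
    \<comment> \<open>If \<open>\<xi>\<close> is within \<open>h\<close> of \<open>x0\<close> and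
      \<open>\<xi> \<odot> q\<close> is within 2 of \<open>p\<close>, then \<open>p\<close> belongs
      to \<open>P q\<close>.\<close>
    define P where "P q = lipschitz \<inter> cball (x0 \<odot> q) (h * norm q + 2)" for q
    define U where "U q = (\<Union>p\<in>P q. cball (p \<odot> qinv q) (2 / (real N * norm q)))" for q
    define S where "S = (\<Union>q\<in>Q. U q)"
    have Qsub: "Q \<subseteq> lipschitz \<inter> cball 0 (real N / 64)" by (auto simp: Q_def)
    then have finQ: "finite Q" using finite_lipschitz_cball finite_subset by blast
    have finP: "finite (P q)" for q unfolding P_def by (rule finite_lipschitz_cball)
    have U: "U q \<in> lmeasurable" for q
      unfolding U_def by (intro fmeasurable.finite_UN finP) auto
    have S: "S \<in> lmeasurable" unfolding S_def by (intro fmeasurable.finite_UN finQ U)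
    have mU: "measure lebesgue (U q) \<le> unit_ball_vol 4 * (16 / real N ^ 4 * (2 * h + 5 / norm q) ^ 4)"
      if "q \<in> Q" for q
    proof -
      have q: "0 < norm q" using that by (auto simp: Q_def)
      have "measure lebesgue (U q) \<le> unit_ball_vol 4 * (real (card (P q)) * (2 / (real N * norm q)) ^ 4)"
        unfolding U_def by (intro measure_UN_cball_le finP) (use q in simp)
      also have "\<dots> \<le> unit_ball_vol 4 * ((2 * (h * norm q + 2) + 1) ^ 4 * (2 / (real N * norm q)) ^ 4)"
        unfolding P_def using unit_ball_vol_4_pos
        by (intro mult_left_mono mult_right_mono card_lipschitz_cball) auto
      also have "(2 * (h * norm q + 2) + 1) ^ 4 * (2 / (real N * norm q)) ^ 4
          = (2 / real N * (2 * h + 5 / norm q)) ^ 4"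
      proof -
        have "(2 * (h * norm q + 2) + 1) * (2 / (real N * norm q)) = 2 / real N * (2 * h + 5 / norm q)"
          using q N1 by (simp add: field_simps)
        then show ?thesis by (metis power_mult_distrib)
      qed
      also have "\<dots> = 16 / real N ^ 4 * (2 * h + 5 / norm q) ^ 4"
        by (simp only: power_mult_distrib power_divide) simp
      finally show ?thesis .
    qed
    have pw: "(2 * h + 5 / norm q) ^ 4 \<le> 81 * h ^ 4 + (if q \<in> cball 0 L then (2 * h + 5) ^ 4 else 0)"
      if "q \<in> Q" for q
    proof (cases "q \<in> cball 0 L")
      case True
      have "1 \<le> norm q" using that lipschitz_subset_hurwitz norm_hurwitz_ge_1 by (auto simp: Q_def)
      then have "(2 * h + 5 / norm q) ^ 4 \<le> (2 * h + 5) ^ 4"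
        using h by (intro power_mono add_left_mono) (auto simp: divide_le_eq)
      moreover have "0 \<le> 81 * h ^ 4" by simp
      ultimately have "(2 * h + 5 / norm q) ^ 4 \<le> 81 * h ^ 4 + (2 * h + 5) ^ 4" by linarith
      then show ?thesis using True by simp
    next
      case False
      then have "5 < h * norm q" using h by (simp add: L_def field_simps)
      moreover have "0 < norm q" using that by (simp add: Q_def)
      ultimately have "5 / norm q \<le> h" by (simp add: divide_le_eq)
      then have "(2 * h + 5 / norm q) ^ 4 \<le> (3 * h) ^ 4"
        using h by (intro power_mono) auto
      then show ?thesis using False by (simp add: power_mult_distrib)
    qed
    have "(\<Sum>q\<in>Q. (2 * h + 5 / norm q) ^ 4)
        \<le> (\<Sum>q\<in>Q. 81 * h ^ 4 + (if q \<in> cball 0 L then (2 * h + 5) ^ 4 else 0))"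
      by (intro sum_mono pw)
    also have "\<dots> = real (card Q) * (81 * h ^ 4) + real (card (Q \<inter> cball 0 L)) * (2 * h + 5) ^ 4"
      using finQ by (simp add: sum.distrib sum.If_cases Int_def)
    also have "\<dots> \<le> (real N / 16) ^ 4 * (81 * h ^ 4) + K"
    proof (intro add_mono mult_right_mono)
      have "real (card Q) \<le> real (card (lipschitz \<inter> cball 0 (real N / 64)))"
        using Qsub finite_lipschitz_cball by (simp add: card_mono)
      also have "\<dots> \<le> (2 * (real N / 64) + 1) ^ 4" by (rule card_lipschitz_cball)
      also have "\<dots> \<le> (real N / 16) ^ 4" using N by (intro power_mono) auto
      finally show "real (card Q) \<le> (real N / 16) ^ 4" .
      have "real (card (Q \<inter> cball 0 L)) \<le> real (card (lipschitz \<inter> cball 0 L))"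
        using Qsub finite_lipschitz_cball by (intro of_nat_mono card_mono) auto
      then show "real (card (Q \<inter> cball 0 L)) * (2 * h + 5) ^ 4 \<le> K"
        unfolding K_def using h by (intro mult_right_mono) auto
    qed auto
    finally have sQ: "(\<Sum>q\<in>Q. (2 * h + 5 / norm q) ^ 4) \<le> (real N / 16) ^ 4 * (81 * h ^ 4) + K" .
    have "measure lebesgue S \<le> (\<Sum>q\<in>Q. measure lebesgue (U q))"
      unfolding S_def using U by (intro measure_UNION_le finQ) (auto simp: fmeasurableD)
    also have "\<dots> \<le> (\<Sum>q\<in>Q. unit_ball_vol 4 * (16 / real N ^ 4 * (2 * h + 5 / norm q) ^ 4))"
      by (intro sum_mono mU)
    also have "\<dots> = unit_ball_vol 4 * (16 / real N ^ 4 * (\<Sum>q\<in>Q. (2 * h + 5 / norm q) ^ 4))"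
      by (simp add: sum_distrib_left)
    also have "\<dots> \<le> unit_ball_vol 4 * (16 / real N ^ 4 * ((real N / 16) ^ 4 * (81 * h ^ 4) + K))"
      using unit_ball_vol_4_pos by (intro mult_left_mono sQ) auto
    also have "\<dots> \<le> unit_ball_vol 4 * (h ^ 4 / 2)"
    proof (intro mult_left_mono)
      have "real N \<le> real N ^ 4" using power_increasing[of 1 4 "real N"] N1 by simp
      then have "64 * K / h ^ 4 \<le> real N ^ 4" using N(2) by linarith
      then have "16 * K \<le> real N ^ 4 * h ^ 4 / 4" using h by (simp add: field_simps)
      then have "16 * K / real N ^ 4 \<le> h ^ 4 / 4" using N1 by (simp add: field_simps)
      \<comment> \<open>The main term has the factor \<open>16 * 81 / 16 ^ 4 = 81 / 4096\<close>,
        which is less than 1/4.\<close>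
      moreover have "16 / real N ^ 4 * ((real N / 16) ^ 4 * (81 * h ^ 4) + K)
          = 81 / 4096 * h ^ 4 + 16 * K / real N ^ 4"
        using N1 by (simp add: field_simps)
      moreover have "0 \<le> h ^ 4" by simp
      ultimately show "16 / real N ^ 4 * ((real N / 16) ^ 4 * (81 * h ^ 4) + K) \<le> h ^ 4 / 2"
        by linarith
    qed (use unit_ball_vol_4_pos in auto)
    finally have mS: "measure lebesgue S \<le> unit_ball_vol 4 * (h ^ 4 / 2)" .
    have "ball x0 h \<subseteq> S \<union> (\<Union>x\<in>level N. cball x (128 / (real N)\<^sup>2))"
    proof
      fix \<xi> assume "\<xi> \<in> ball x0 h"
      then have \<xi>: "norm (\<xi> - x0) \<le> h" by (simp add: dist_norm norm_minus_commute)
      obtain p q where pq: "p \<in> lipschitz" "q \<in> lipschitz" "q \<noteq> 0" "norm q \<le> 2 * real N"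
        "norm (\<xi> \<odot> q - p) \<le> 2 / real N"
        using dirichlet_quat[of N \<xi>] N by auto
      have q: "0 < norm q" using pq(3) by simp
      have d: "dist (p \<odot> qinv q) \<xi> \<le> 2 / real N / norm q"
        using divide_right_mono[OF pq(5) norm_ge_zero[of q]]
        by (metis dist_commute dist_norm norm_diff_fraction[OF pq(3)])
      show "\<xi> \<in> S \<union> (\<Union>x\<in>level N. cball x (128 / (real N)\<^sup>2))"
      proof (cases "real N / 64 < norm q")
        case True
        then have "2 / real N / norm q \<le> 2 / real N / (real N / 64)"
          using N1 q by (intro divide_left_mono mult_pos_pos) auto
        also have "\<dots> = 128 / (real N)\<^sup>2" by (simp add: power2_eq_square)
        finally have "\<xi> \<in> cball (p \<odot> qinv q) (128 / (real N)\<^sup>2)" using d by simp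
        moreover have "p \<odot> qinv q \<in> level N" unfolding level_def using pq True by blast
        ultimately show ?thesis by blast
      next
        case False
        then have "q \<in> Q" using pq by (simp add: Q_def)
        moreover have "p \<in> P q"
        proof -
          have "x0 \<odot> q - p = (\<xi> \<odot> q - p) - (\<xi> - x0) \<odot> q" by (simp add: qmult_diff_right)
          then have "norm (x0 \<odot> q - p) \<le> norm (\<xi> \<odot> q - p) + norm ((\<xi> - x0) \<odot> q)"
            by (metis norm_triangle_ineq4)
          also have "\<dots> \<le> 2 + h * norm q"
          proof (rule add_mono)
            have "2 / real N \<le> 2" using N1 by (simp add: field_simps)
            then show "norm (\<xi> \<odot> q - p) \<le> 2" using pq(5) by linarith
            show "norm ((\<xi> - x0) \<odot> q) \<le> h * norm q"
              unfolding norm_qmult using \<xi> by (intro mult_right_mono) auto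
          qed
          finally show ?thesis using pq(1) by (simp add: P_def dist_norm)
        qed
        moreover have "\<xi> \<in> cball (p \<odot> qinv q) (2 / (real N * norm q))" using d by simp
        ultimately show ?thesis unfolding S_def U_def by blast
      qed
    qed
    with S mS show ?thesis by blast
  qed
  have "\<forall>\<^sub>F N in sequentially. 64 * K / h ^ 4 \<le> real N"
    using filterlim_real_sequentially by (simp add: filterlim_at_top)
  then show ?thesis
    using eventually_ge_at_top[of 32] by eventually_elim (rule *)
qed

text \<open>The packing bound caps the size of separated subsets, so one of greatest cardinality
  exists; a point at distance at least \<open>s\<close> from all of it could be added.\<close>

lemma exists_maximal_separated:
  fixes A :: "quat set"
  assumes "0 < s" "A \<subseteq> cball x R"
  obtains Z where "Z \<subseteq> A" "finite Z" "\<And>a b. a \<in> Z \<Longrightarrow> b \<in> Z \<Longrightarrow> a \<noteq> b \<Longrightarrow> s \<le> dist a b"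
    "\<And>a. a \<in> A \<Longrightarrow> \<exists>z\<in>Z. dist a z < s"
proof -
  define P where "P Z \<longleftrightarrow> Z \<subseteq> A \<and> finite Z \<and> (\<forall>a\<in>Z. \<forall>b\<in>Z. a \<noteq> b \<longrightarrow> s \<le> dist a b)" for Z
  have "P {}" by (simp add: P_def)
  moreover have "\<forall>Z. P Z \<longrightarrow> card Z < nat \<lceil>(2 * R / s + 1) ^ 4\<rceil> + 1"
  proof (intro allI impI)
    fix Z assume "P Z"
    then have "real (card Z) \<le> (2 * R / s + 1) ^ 4"
      using assms by (intro card_separated_le[of Z s x R]) (auto simp: P_def)
    then show "card Z < nat \<lceil>(2 * R / s + 1) ^ 4\<rceil> + 1" by linarith
  qed
  ultimately obtain Z where Z: "P Z" "\<forall>Z'. P Z' \<longrightarrow> card Z' \<le> card Z"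
    using ex_has_greatest_nat[of P "{}" card] by blast
  show thesis
  proof (rule that)
    show "Z \<subseteq> A" "finite Z" "\<And>a b. a \<in> Z \<Longrightarrow> b \<in> Z \<Longrightarrow> a \<noteq> b \<Longrightarrow> s \<le> dist a b"
      using Z(1) by (auto simp: P_def)
    show "\<exists>z\<in>Z. dist a z < s" if "a \<in> A" for a
    proof (rule ccontr)
      assume far: "\<not> (\<exists>z\<in>Z. dist a z < s)"
      then have "a \<notin> Z" using assms(1) by force
      moreover have "P (insert a Z)" using Z(1) far that by (auto simp: P_def dist_commute not_less)
      moreover have "finite Z" using Z(1) by (simp add: P_def)
      ultimately show False using Z(2) by (metis card_insert_disjoint Suc_n_not_le_n)
    qed
  qed
qed

text \<open>Ubiquity with \<open>h = r / 2\<close> bounds the size of a maximal separated set from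
  below, packing bounds it from above. Once the spacing is below \<open>r / 4\<close>, all level
  points near \<open>ball x0 (r/2)\<close> lie within \<open>3 * r / 4\<close> of \<open>x0\<close>,
  which leaves a margin inside the ball of radius \<open>r\<close>.\<close>

lemma level_separated:
  fixes x0 :: quat
  assumes r: "0 < r"
  shows "\<forall>\<^sub>F N in sequentially. \<exists>Z. finite Z \<and> Z \<subseteq> level N \<inter> ball x0 (3 * r / 4) \<and>
    (\<forall>a\<in>Z. \<forall>b\<in>Z. a \<noteq> b \<longrightarrow> 128 / (real N)\<^sup>2 \<le> dist a b) \<and>
    r ^ 4 / 512 \<le> real (card Z) * (128 / (real N)\<^sup>2) ^ 4 \<and>
    real (card Z) * (128 / (real N)\<^sup>2) ^ 4 \<le> 16 * r ^ 4"
proof -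
  have "((\<lambda>N. 128 / (real N)\<^sup>2) \<longlongrightarrow> 0) sequentially"
    by (intro tendsto_divide_0[OF tendsto_const] filterlim_at_top_imp_at_infinity filterlim_pow_at_top
        filterlim_real_sequentially) auto
  then have "\<forall>\<^sub>F N in sequentially. 128 / (real N)\<^sup>2 < r / 4"
    using r by (intro order_tendstoD(2)) auto
  then show ?thesis
    using ubiquity[OF half_gt_zero[OF r], of x0] eventually_ge_at_top[of 1]
  proof eventually_elim
    case (elim N)
    define s where "s = 128 / (real N)\<^sup>2"
    have s: "0 < s" "s < r / 4" using elim by (auto simp: s_def)
    obtain S where S: "S \<in> lmeasurable" "measure lebesgue S \<le> unit_ball_vol 4 * ((r/2) ^ 4 / 2)"
      "ball x0 (r/2) \<subseteq> S \<union> (\<Union>x\<in>level N. cball x s)"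
      using elim r unfolding s_def by auto
    obtain Z where Z: "Z \<subseteq> level N \<inter> ball x0 (3 * r / 4)" "finite Z"
      "\<And>a b. a \<in> Z \<Longrightarrow> b \<in> Z \<Longrightarrow> a \<noteq> b \<Longrightarrow> s \<le> dist a b"
      "\<And>a. a \<in> level N \<inter> ball x0 (3 * r / 4) \<Longrightarrow> \<exists>z\<in>Z. dist a z < s"
    proof (rule exists_maximal_separated[OF s(1)])
      show "level N \<inter> ball x0 (3 * r / 4) \<subseteq> cball x0 (3 * r / 4)" by auto
    qed blast
    \<comment> \<open>Every relevant level point is within \<open>s\<close> of \<open>Z\<close>, so
      doubling the radius lets \<open>Z\<close> replace the whole level.\<close>
    have cov: "ball x0 (r/2) \<subseteq> S \<union> (\<Union>z\<in>Z. cball z (2 * s))"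
    proof
      fix y assume y: "y \<in> ball x0 (r/2)"
      show "y \<in> S \<union> (\<Union>z\<in>Z. cball z (2 * s))"
      proof (cases "y \<in> S")
        case False
        then obtain x where x: "x \<in> level N" "dist x y \<le> s" using S(3) y by auto
        then have "dist x0 x < 3 * r / 4"
          using y s dist_triangle[of x0 x y] by (simp add: dist_commute)
        then obtain z where z: "z \<in> Z" "dist x z < s" using Z(4)[of x] x by auto
        then have "dist z y \<le> 2 * s" using x dist_triangle3[of z y x] by linarith
        then show ?thesis using z by auto
      qed simp
    qed
    have "unit_ball_vol 4 * (r/2) ^ 4 = measure lebesgue (ball x0 (r/2))"
      using r by (simp add: content_ball)
    also have "\<dots> \<le> measure lebesgue (S \<union> (\<Union>z\<in>Z. cball z (2 * s)))"
      using S(1) Z(2) by (intro measure_mono_fmeasurable cov fmeasurable.Un fmeasurable.finite_UN) auto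
    also have "\<dots> \<le> measure lebesgue S + measure lebesgue (\<Union>z\<in>Z. cball z (2 * s))"
      using S(1) Z(2) by (intro measure_Un_le) (auto simp: fmeasurableD intro!: sets.finite_UN)
    also have "\<dots> \<le> unit_ball_vol 4 * ((r/2) ^ 4 / 2) + unit_ball_vol 4 * (real (card Z) * (2 * s) ^ 4)"
      using s by (intro add_mono S(2) measure_UN_cball_le Z(2)) auto
    finally have "unit_ball_vol 4 * (r/2) ^ 4
        \<le> unit_ball_vol 4 * ((r/2) ^ 4 / 2 + real (card Z) * (2 * s) ^ 4)"
      by (simp only: distrib_left)
    then have "(r/2) ^ 4 \<le> (r/2) ^ 4 / 2 + real (card Z) * (2 * s) ^ 4"
      using unit_ball_vol_4_pos mult_le_cancel_left_pos by blast
    then have lower: "r ^ 4 / 512 \<le> real (card Z) * s ^ 4"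
      by (simp add: power_divide power_mult_distrib)
    have "real (card Z) \<le> (2 * (3 * r / 4) / s + 1) ^ 4"
      using Z by (intro card_separated_le[OF Z(2) s(1), where x=x0]) auto
    also have "\<dots> \<le> (2 * r / s) ^ 4"
      
    proof (intro power_mono)
      have "1 \<le> r / (2 * s)" using s by (simp add: field_simps)
      then show "2 * (3 * r / 4) / s + 1 \<le> 2 * r / s" by (simp add: field_simps)
    qed (use s r in simp)
    also have "\<dots> = 16 * r ^ 4 / s ^ 4" by (simp add: power_divide power_mult_distrib)
    finally have upper: "real (card Z) * s ^ 4 \<le> 16 * r ^ 4"
      using s(1) by (simp add: pos_le_divide_eq)
    show ?case
      using Z(1-3) lower upper unfolding s_def by blast
  qed
qed


section \<open>Disjoint families of enlarged balls\<close>

lemma pow4_add_le: "(a + b) ^ 4 \<le> 8 * (a ^ 4 + b ^ 4)" for a b :: real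
proof -
  have "(a + b)\<^sup>2 \<le> 2 * (a\<^sup>2 + b\<^sup>2)"
    using sum_squares_bound[of a b] by (simp add: power2_sum)
  then have "((a + b)\<^sup>2)\<^sup>2 \<le> (2 * (a\<^sup>2 + b\<^sup>2))\<^sup>2" by (intro power_mono) auto
  also have "\<dots> \<le> 8 * ((a\<^sup>2)\<^sup>2 + (b\<^sup>2)\<^sup>2)"
    using sum_squares_bound[of "a\<^sup>2" "b\<^sup>2"] by (simp add: power2_sum power_mult_distrib)
  finally show ?thesis by (simp add: power_mult[symmetric])
qed

text \<open>The approximation quality \<open>128 / N\<^sup>2\<close> at
  \<open>N = 8 ^ k\<close>.\<close>

definition spacing :: "nat \<Rightarrow> real" where
  "spacing k = 128 / 64 ^ k"

lemma spacing_pos: "0 < spacing k"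
  by (simp add: spacing_def)

lemma spacing_Suc: "spacing (Suc k) = spacing k / 64"
  by (simp add: spacing_def)

lemma spacing_eq: "128 / (real (8 ^ k))\<^sup>2 = spacing k"
  by (simp add: spacing_def power_mult[symmetric] power2_eq_square power_mult_distrib[symmetric])

text \<open>
  A pair \<open>(k, x)\<close> in \<open>Y\<close> stands for the ball of centre \<open>x\<close> and radius \<open>R k\<close>.
\<close>

definition ball_family :: "(nat \<Rightarrow> real) \<Rightarrow> nat \<Rightarrow> quat \<Rightarrow> real \<Rightarrow> (nat \<times> quat) set \<Rightarrow> bool" where
  "ball_family R k0 x0 r Y \<longleftrightarrow> finite Y \<and>
     (\<forall>(k, x)\<in>Y. k0 \<le> k \<and> x \<in> level (8 ^ k) \<and> x \<in> ball x0 r) \<and>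
     (\<forall>(k, x)\<in>Y. \<forall>(l, y)\<in>Y. (k, x) \<noteq> (l, y) \<longrightarrow> R k + R l \<le> dist x y)"

text \<open>Bounds how many candidate centres a ball of radius \<open>u\<close> about
  \<open>y\<close> excludes for new balls of radius \<open>v\<close>: they lie within
  \<open>u + s/2\<close> of \<open>y\<close> and are packed with separation
  \<open>s\<close>.\<close>

lemma card_hit_le:
  fixes Z :: "quat set"
  assumes "finite Z" "0 < s" "\<And>a b. a \<in> Z \<Longrightarrow> b \<in> Z \<Longrightarrow> a \<noteq> b \<Longrightarrow> s \<le> dist a b"
    and "0 \<le> u" "2 * v \<le> s"
  shows "real (card {z \<in> Z. dist y z < u + v}) * s ^ 4 \<le> 128 * (u ^ 4 + s ^ 4)"
proof -
  have "real (card {z \<in> Z. dist y z < u + v}) \<le> (2 * (u + s/2) / s + 1) ^ 4"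
    by (rule card_separated_le[where x=y]) (use assms in auto)
  also have "\<dots> = (2 * u + 2 * s) ^ 4 / s ^ 4"
    using assms(2) by (simp add: power_divide[symmetric] add_divide_distrib add.commute)
  finally have "real (card {z \<in> Z. dist y z < u + v}) * s ^ 4 \<le> (2 * u + 2 * s) ^ 4"
    using assms(2) by (simp add: pos_le_divide_eq)
  also have "\<dots> \<le> 8 * ((2 * u) ^ 4 + (2 * s) ^ 4)" by (rule pow4_add_le)
  finally show ?thesis by (simp add: power_mult_distrib)
qed

text \<open>One greedy step: candidates in conflict with older balls are discarded. The two
  smallness hypotheses limit the loss to half of the guaranteed \<open>r ^ 4 / 512\<close>, whence
  the denominator \<open>2 ^ 10\<close> in the gain.\<close>

lemma ball_family_extend:
  assumes Y: "ball_family R k0 x0 \<rho> Y" "\<And>l y. (l, y) \<in> Y \<Longrightarrow> l < k" "k0 \<le> k"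
    and R: "\<And>k. 0 < R k" "2 * R k \<le> spacing k"
    and Z: "finite Z" "Z \<subseteq> level (8 ^ k) \<inter> ball x0 \<rho>"
      "\<And>a b. a \<in> Z \<Longrightarrow> b \<in> Z \<Longrightarrow> a \<noteq> b \<Longrightarrow> spacing k \<le> dist a b"
      "r ^ 4 / 512 \<le> real (card Z) * spacing k ^ 4" "real (card Z) * spacing k ^ 4 \<le> 16 * r ^ 4"
    and small: "(\<Sum>(l, y)\<in>Y. R l ^ 4) \<le> r ^ 4 / 2 ^ 18"
    and card: "real (card Y) * spacing k ^ 4 \<le> r ^ 4 / 2 ^ 18"
  obtains Y' where "ball_family R k0 x0 \<rho> Y'" "\<And>l y. (l, y) \<in> Y' \<Longrightarrow> l < Suc k"
    "(\<Sum>(l, y)\<in>Y. R l ^ 4) + r ^ 4 / 2 ^ 10 * (R k / spacing k) ^ 4 \<le> (\<Sum>(l, y)\<in>Y'. R l ^ 4)"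
    "real (card Y') * spacing (Suc k) ^ 4 \<le> r ^ 4 / 2 ^ 18"
proof -
  define s where "s = spacing k"
  have s: "0 < s" by (simp add: s_def spacing_pos)
  have finY: "finite Y" using Y(1) by (simp add: ball_family_def)
  \<comment> \<open>\<open>H p\<close> consists of the candidates whose ball could overlap the older
    ball \<open>p\<close>.\<close>
  define H where "H = (\<lambda>(l, y). {z \<in> Z. dist y z < R l + R k})"
  define N where "N = Z - (\<Union>p\<in>Y. H p)"
  have finN: "finite N" using Z(1) by (simp add: N_def)
  have H: "real (card (H (l, y))) * s ^ 4 \<le> 128 * (R l ^ 4 + s ^ 4)" for l y
    unfolding H_def s_def prod.case
    by (rule card_hit_le) (use Z R spacing_pos in \<open>auto intro: less_imp_le\<close>)
  have "card Z \<le> card (N \<union> (\<Union>p\<in>Y. H p))"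
    by (rule card_mono) (use finN finY Z(1) in \<open>auto simp: N_def H_def\<close>)
  also have "\<dots> \<le> card N + card (\<Union>p\<in>Y. H p)" by (rule card_Un_le)
  also have "\<dots> \<le> card N + (\<Sum>p\<in>Y. card (H p))"
    by (intro add_left_mono card_UN_le finY)
  finally have "real (card Z) \<le> real (card N) + (\<Sum>p\<in>Y. real (card (H p)))"
    by (metis of_nat_add of_nat_le_iff of_nat_sum)
  then have "real (card Z) * s ^ 4 \<le> (real (card N) + (\<Sum>p\<in>Y. real (card (H p)))) * s ^ 4"
    using s by (intro mult_right_mono) auto
  also have "\<dots> = real (card N) * s ^ 4 + (\<Sum>p\<in>Y. real (card (H p)) * s ^ 4)"
    by (simp add: distrib_right sum_distrib_right)
  also have "\<dots> \<le> real (card N) * s ^ 4 + (\<Sum>(l, y)\<in>Y. 128 * (R l ^ 4 + s ^ 4))"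
    by (intro add_left_mono sum_mono) (use H in auto)
  also have "(\<Sum>(l, y)\<in>Y. 128 * (R l ^ 4 + s ^ 4)) = 128 * ((\<Sum>(l, y)\<in>Y. R l ^ 4) + real (card Y) * s ^ 4)"
    by (simp add: case_prod_unfold sum_distrib_left[symmetric] sum.distrib)
  also have "\<dots> \<le> 128 * (r ^ 4 / 2 ^ 18 + r ^ 4 / 2 ^ 18)"
    unfolding s_def by (intro mult_left_mono add_mono small card) simp
  finally have "r ^ 4 / 512 \<le> real (card N) * s ^ 4 + 128 * (r ^ 4 / 2 ^ 18 + r ^ 4 / 2 ^ 18)"
    using Z(4) unfolding s_def by simp
  then have N: "r ^ 4 / 2 ^ 10 \<le> real (card N) * s ^ 4" by simp
  define Y' where "Y' = Y \<union> {k} \<times> N"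
  have disj: "Y \<inter> ({k} \<times> N) = {}" using Y(2) by auto
  have far: "R l + R k \<le> dist y z" if "(l, y) \<in> Y" "z \<in> N" for l y z
    using that by (force simp: N_def H_def)
  show thesis
  proof (rule that[of Y'])
    have "R k + R k \<le> dist a b" if "a \<in> N" "b \<in> N" "a \<noteq> b" for a b
      using Z(3)[of a b] that R(2) by (auto simp: N_def)
    moreover have "R k + R l \<le> dist z y" if "(l, y) \<in> Y" "z \<in> N" for l y z
      using far[OF that] by (simp add: dist_commute add.commute)
    moreover have "N \<subseteq> level (8 ^ k) \<inter> ball x0 \<rho>" using Z(2) by (auto simp: N_def)
    ultimately show "ball_family R k0 x0 \<rho> Y'"
      using Y(1,3) finN far unfolding ball_family_def Y'_def by (auto; blast)
    show "l < Suc k" if "(l, y) \<in> Y'" for l y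
      using that Y(2)[of l y] by (auto simp: Y'_def)
    have "r ^ 4 / 2 ^ 10 * (R k / s) ^ 4 \<le> (real (card N) * s ^ 4) * (R k / s) ^ 4"
      using R(1)[of k] s by (intro mult_right_mono N) auto
    also have "\<dots> = real (card N) * R k ^ 4" using s by (simp add: power_divide)
    also have "\<dots> = (\<Sum>(l, y)\<in>{k} \<times> N. R l ^ 4)"
      by (simp add: sum.cartesian_product[symmetric])
    finally show "(\<Sum>(l, y)\<in>Y. R l ^ 4) + r ^ 4 / 2 ^ 10 * (R k / spacing k) ^ 4 \<le> (\<Sum>(l, y)\<in>Y'. R l ^ 4)"
      unfolding Y'_def s_def using finY finN disj by (subst sum.union_disjoint) auto
    have "real (card Y') = real (card Y) + real (card N)"
      unfolding Y'_def using finY finN disj by (subst card_Un_disjoint) (auto simp: card_cartesian_product)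
    also have "\<dots> \<le> real (card Y) + real (card Z)"
      using Z(1) by (simp add: N_def card_mono Diff_subset)
    finally have "real (card Y') * s ^ 4 \<le> (real (card Y) + real (card Z)) * s ^ 4"
      using s by (intro mult_right_mono) auto
    then have "real (card Y') * s ^ 4 \<le> r ^ 4 / 2 ^ 18 + 16 * r ^ 4"
      using card Z(5) by (simp add: distrib_right s_def)
    \<comment> \<open>The next level divides the fourth power of the spacing by
      \<open>64 ^ 4 = 2 ^ 24\<close>, which pushes even \<open>16 * r ^ 4\<close> below the
      threshold.\<close>
    then have "real (card Y') * s ^ 4 / 2 ^ 24 \<le> (r ^ 4 / 2 ^ 18 + 16 * r ^ 4) / 2 ^ 24"
      by (rule divide_right_mono) simp
    also have "\<dots> \<le> r ^ 4 / 2 ^ 18" by simp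
    finally show "real (card Y') * spacing (Suc k) ^ 4 \<le> r ^ 4 / 2 ^ 18"
      by (simp only: spacing_Suc s_def power_divide) simp
  qed
qed

text \<open>
  The ball families are built greedily, one level at a time: as long as the total volume is small,
  the balls chosen so far meet only a small proportion of a maximal separated subset of the next
  level, so that the volume grows by a fixed multiple of \<open>(R k / spacing k) ^ 4\<close>. The ratio 8 of
  successive levels makes the number of balls from earlier levels negligible.
\<close>

lemma exists_large_ball_family:
  assumes r: "0 < r" and R: "\<And>k. 0 < R k" "\<And>k. 2 * R k \<le> spacing k"
    and div: "\<not> summable (\<lambda>k. (R k / spacing k) ^ 4)"
  obtains Y where "ball_family R k0 x0 (3 * r / 4) Y" "r ^ 4 / 2 ^ 18 \<le> (\<Sum>(k, x)\<in>Y. R k ^ 4)"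
proof -
  have "filterlim (\<lambda>k. 8 ^ k :: nat) sequentially sequentially"
    by (rule filterlim_subseq) (simp add: strict_mono_def)
  from eventually_compose_filterlim[OF level_separated[OF r, of x0] this]
  obtain k1 where k1: "\<And>k. k1 \<le> k \<Longrightarrow> \<exists>Z. finite Z \<and> Z \<subseteq> level (8 ^ k) \<inter> ball x0 (3 * r / 4) \<and>
    (\<forall>a\<in>Z. \<forall>b\<in>Z. a \<noteq> b \<longrightarrow> spacing k \<le> dist a b) \<and>
    r ^ 4 / 512 \<le> real (card Z) * spacing k ^ 4 \<and> real (card Z) * spacing k ^ 4 \<le> 16 * r ^ 4"
    unfolding eventually_sequentially spacing_eq by blast
  define M where "M = max k0 k1"
  \<comment> \<open>Invariant: either the target volume is reached, and the family is kept from then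
    on, or every level since \<open>M\<close> has contributed its share.\<close>
  have *: "\<exists>Y. ball_family R k0 x0 (3 * r / 4) Y \<and> (\<forall>(l, y)\<in>Y. l < K) \<and>
     real (card Y) * spacing K ^ 4 \<le> r ^ 4 / 2 ^ 18 \<and>
     (r ^ 4 / 2 ^ 18 \<le> (\<Sum>(k, x)\<in>Y. R k ^ 4) \<or>
      r ^ 4 / 2 ^ 10 * (\<Sum>k=M..<K. (R k / spacing k) ^ 4) \<le> (\<Sum>(k, x)\<in>Y. R k ^ 4))" if "M \<le> K" for K
    using that
  proof (induction K rule: dec_induct)
    case base
    show ?case by (rule exI[of _ "{}"]) (use r in \<open>simp add: ball_family_def\<close>)
  next
    case (step K)
    then obtain Y where Y: "ball_family R k0 x0 (3 * r / 4) Y" "\<forall>(l, y)\<in>Y. l < K"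
      "real (card Y) * spacing K ^ 4 \<le> r ^ 4 / 2 ^ 18"
      "r ^ 4 / 2 ^ 18 \<le> (\<Sum>(k, x)\<in>Y. R k ^ 4) \<or>
        r ^ 4 / 2 ^ 10 * (\<Sum>k=M..<K. (R k / spacing k) ^ 4) \<le> (\<Sum>(k, x)\<in>Y. R k ^ 4)"
      by blast
    show ?case
    proof (cases "r ^ 4 / 2 ^ 18 \<le> (\<Sum>(k, x)\<in>Y. R k ^ 4)")
      case True
      have "real (card Y) * spacing (Suc K) ^ 4 \<le> real (card Y) * spacing K ^ 4"
        using spacing_pos[of K] by (intro mult_left_mono power_mono) (auto simp: spacing_Suc)
      with Y(3) have "real (card Y) * spacing (Suc K) ^ 4 \<le> r ^ 4 / 2 ^ 18" by linarith
      then show ?thesis using Y(1,2) True by (intro exI[of _ Y]) auto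
    next
      case False
      have KM: "k1 \<le> K" "k0 \<le> K" using step by (auto simp: M_def)
      obtain Z where Z: "finite Z" "Z \<subseteq> level (8 ^ K) \<inter> ball x0 (3 * r / 4)"
        "\<forall>a\<in>Z. \<forall>b\<in>Z. a \<noteq> b \<longrightarrow> spacing K \<le> dist a b"
        "r ^ 4 / 512 \<le> real (card Z) * spacing K ^ 4" "real (card Z) * spacing K ^ 4 \<le> 16 * r ^ 4"
        using k1[OF KM(1)] by blast
      obtain Y' where Y': "ball_family R k0 x0 (3 * r / 4) Y'" "\<And>l y. (l, y) \<in> Y' \<Longrightarrow> l < Suc K"
        "(\<Sum>(l, y)\<in>Y. R l ^ 4) + r ^ 4 / 2 ^ 10 * (R K / spacing K) ^ 4 \<le> (\<Sum>(l, y)\<in>Y'. R l ^ 4)"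
        "real (card Y') * spacing (Suc K) ^ 4 \<le> r ^ 4 / 2 ^ 18"
      proof (rule ball_family_extend[OF Y(1) _ KM(2) R(1) R(2) Z(1,2) _ Z(4,5)])
        show "\<And>l y. (l, y) \<in> Y \<Longrightarrow> l < K" using Y(2) by blast
        show "\<And>a b. a \<in> Z \<Longrightarrow> b \<in> Z \<Longrightarrow> a \<noteq> b \<Longrightarrow> spacing K \<le> dist a b" using Z(3) by blast
        show "(\<Sum>(l, y)\<in>Y. R l ^ 4) \<le> r ^ 4 / 2 ^ 18" using False by linarith
      qed (use Y(3) in auto)
      have "r ^ 4 / 2 ^ 10 * (\<Sum>k=M..<Suc K. (R k / spacing k) ^ 4)
          = r ^ 4 / 2 ^ 10 * (\<Sum>k=M..<K. (R k / spacing k) ^ 4) + r ^ 4 / 2 ^ 10 * (R K / spacing K) ^ 4"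
        using step(1) by (simp add: distrib_left)
      also have "\<dots> \<le> (\<Sum>(l, y)\<in>Y'. R l ^ 4)" using Y(4) False Y'(3) by linarith
      finally show ?thesis using Y'(1,2,4) by (intro exI[of _ Y']) auto
    qed
  qed
  \<comment> \<open>Since \<open>2 ^ 10 * 2 ^ 8 = 2 ^ 18\<close>, a partial sum of this size reaches
    the target; the divergent series of nonnegative terms has one.\<close>
  have "\<exists>K\<ge>M. 1 / 2 ^ 8 \<le> (\<Sum>k=M..<K. (R k / spacing k) ^ 4)"
  proof (rule ccontr)
    assume neg: "\<not> ?thesis"
    have b: "(\<Sum>k=M..<K. (R k / spacing k) ^ 4) \<le> 1" if "M \<le> K" for K
    proof -
      have "(\<Sum>k=M..<K. (R k / spacing k) ^ 4) < 1 / 2 ^ 8" using that neg by (meson not_le)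
      also have "(1::real) / 2 ^ 8 \<le> 1" by simp
      finally show ?thesis by (rule less_imp_le)
    qed
    have "summable (\<lambda>k. (R (k + M) / spacing (k + M)) ^ 4)"
    proof (rule bounded_imp_summable)
      fix n
      have "(\<Sum>k\<le>n. (R (k + M) / spacing (k + M)) ^ 4) = (\<Sum>k=M..<Suc n + M. (R k / spacing k) ^ 4)"
        using sum.shift_bounds_nat_ivl[of "\<lambda>k. (R k / spacing k) ^ 4" 0 M "Suc n"]
        by (simp add: atLeast0LessThan lessThan_Suc_atMost)
      then show "(\<Sum>k\<le>n. (R (k + M) / spacing (k + M)) ^ 4) \<le> 1" using b[of "Suc n + M"] by simp
    qed simp
    then show False using div summable_iff_shift[of "\<lambda>k. (R k / spacing k) ^ 4" M] by simp
  qed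
  then obtain K where K: "M \<le> K" "1 / 2 ^ 8 \<le> (\<Sum>k=M..<K. (R k / spacing k) ^ 4)" by blast
  obtain Y where Y: "ball_family R k0 x0 (3 * r / 4) Y"
    "r ^ 4 / 2 ^ 18 \<le> (\<Sum>(k, x)\<in>Y. R k ^ 4) \<or>
      r ^ 4 / 2 ^ 10 * (\<Sum>k=M..<K. (R k / spacing k) ^ 4) \<le> (\<Sum>(k, x)\<in>Y. R k ^ 4)"
    using *[OF K(1)] by blast
  have "r ^ 4 / 2 ^ 10 * (1 / 2 ^ 8) \<le> r ^ 4 / 2 ^ 10 * (\<Sum>k=M..<K. (R k / spacing k) ^ 4)"
    using K(2) by (intro mult_left_mono) auto
  then have "r ^ 4 / 2 ^ 18 \<le> (\<Sum>(k, x)\<in>Y. R k ^ 4)" using Y(2) by (elim disjE) simp_all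
  with Y(1) show thesis by (rule that)
qed


section \<open>The divergence case\<close>

text \<open>The sizes \<open>d i\<close> stand in for the diameters: they are later taken slightly
  larger, so as to be positive even for sets of diameter 0.\<close>

definition hit_mass :: "(real \<Rightarrow> real) \<Rightarrow> (nat \<Rightarrow> quat set) \<Rightarrow> (nat \<Rightarrow> real) \<Rightarrow> quat set \<Rightarrow> ennreal" where
  "hit_mass f C d B = (\<Sum>i. if C i \<inter> B \<noteq> {} then ennreal (f (d i)) else 0)"

lemma le_hit_mass:
  assumes "C i \<inter> B \<noteq> {}" shows "ennreal (f (d i)) \<le> hit_mass f C d B"
proof -
  have "(\<Sum>j\<in>{i}. if C j \<inter> B \<noteq> {} then ennreal (f (d j)) else 0) \<le> hit_mass f C d B"
    unfolding hit_mass_def by (intro sum_le_suminf) auto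
  with assms show ?thesis by simp
qed

text \<open>If \<open>C\<close> meets two of the small balls, the sum \<open>R k + R l\<close> is at
  most \<open>d\<close> plus a quarter of itself, hence at most \<open>4 / 3 * d\<close>. All
  enlarged balls in \<open>J\<close> then lie in one ball of radius \<open>4 * d\<close>, and being
  disjoint they are bounded by its volume.\<close>

lemma sum_pow4_hit_le:
  fixes R \<rho> :: "nat \<Rightarrow> real"
  assumes Y: "ball_family R k0 x0 r Y" and R: "\<And>k. 0 \<le> R k"
    and \<rho>: "\<And>k x. (k, x) \<in> Y \<Longrightarrow> \<rho> k \<le> R k / 4"
    and C: "bounded C" "diameter C \<le> d" "0 \<le> d"
    and J: "J \<subseteq> Y" "\<And>k x. (k, x) \<in> J \<Longrightarrow> C \<inter> cball x (\<rho> k) \<noteq> {}" "a \<in> J" "b \<in> J" "a \<noteq> b"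
  shows "(\<Sum>(k, x)\<in>J. R k ^ 4) \<le> 256 * d ^ 4"
proof -
  have sep: "R k + R l \<le> dist x y" if "(k, x) \<in> J" "(l, y) \<in> J" "(k, x) \<noteq> (l, y)" for k x l y
  proof -
    have "\<forall>(k, x)\<in>Y. \<forall>(l, y)\<in>Y. (k, x) \<noteq> (l, y) \<longrightarrow> R k + R l \<le> dist x y"
      using Y by (simp add: ball_family_def)
    moreover have "(k, x) \<in> Y" "(l, y) \<in> Y" using that J(1) by auto
    ultimately show ?thesis using that(3) by fast
  qed
  have close: "dist x y \<le> \<rho> k + d + \<rho> l" if xy: "(k, x) \<in> J" "(l, y) \<in> J" for k x l y
  proof -
    obtain u v where uv: "u \<in> C" "dist x u \<le> \<rho> k" "v \<in> C" "dist y v \<le> \<rho> l"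
      using J(2)[OF xy(1)] J(2)[OF xy(2)] by auto
    have "dist u v \<le> d" using diameter_bounded_bound[OF C(1) uv(1,3)] C(2) by linarith
    then show ?thesis
      using uv dist_triangle[of x y u] dist_triangle[of u y v] by (simp add: dist_commute)
  qed
  have Rle: "R k + R l \<le> 4 / 3 * d" if "(k, x) \<in> J" "(l, y) \<in> J" "(k, x) \<noteq> (l, y)" for k x l y
    using sep[OF that] close[OF that(1,2)] \<rho>[of k x] \<rho>[of l y] that J(1) by force
  obtain ka xa where a: "a = (ka, xa)" by (cases a)
  obtain kb xb where b: "b = (kb, xb)" by (cases b)
  have finJ: "finite J" using Y J(1) finite_subset unfolding ball_family_def by blast
  have "unit_ball_vol 4 * (\<Sum>p\<in>J. R (fst p) ^ 4) \<le> measure lebesgue (ball xa (4 * d))"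
  proof (rule sum_pow4_disjoint_balls_le[OF finJ])
    show "R (fst p) + R (fst q) \<le> dist (snd p) (snd q)" if "p \<in> J" "q \<in> J" "p \<noteq> q" for p q
      using sep[of "fst p" "snd p" "fst q" "snd q"] that by simp
    show "ball (snd p) (R (fst p)) \<subseteq> ball xa (4 * d)" if "p \<in> J" for p
    proof -
      obtain k x where p: "p = (k, x)" by (cases p)
      have "dist xa x + R k \<le> 4 * d"
      \<comment> \<open>For the central ball itself it is the second ball \<open>b\<close> that
        bounds the radius in terms of \<open>d\<close>.\<close>
      proof (cases "p = a")
        case True
        then show ?thesis using Rle[of ka xa kb xb] J(3-5) a b p R[of kb] C(3) by simp
      next
        case False
        have "dist xa x \<le> \<rho> ka + d + \<rho> k" using close[of ka xa k x] J(3) that a p by simp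
        moreover have "R ka + R k \<le> 4 / 3 * d" using Rle[of ka xa k x] J(3) that a p False by blast
        moreover have "\<rho> ka \<le> R ka / 4" "\<rho> k \<le> R k / 4" using \<rho> J(1,3) that a p by auto
        ultimately show ?thesis using R[of ka] R[of k] C(3) by argo
      qed
      then show ?thesis using p
        by (auto simp: subset_eq) (metis add.commute add_le_cancel_left add_less_cancel_left dist_triangle order_less_le_trans order_le_less_trans)
    qed
  qed (use R in auto)
  also have "\<dots> = unit_ball_vol 4 * (4 * d) ^ 4" using C(3) by (simp add: content_ball)
  finally have "(\<Sum>p\<in>J. R (fst p) ^ 4) \<le> (4 * d) ^ 4"
    using unit_ball_vol_4_pos mult_le_cancel_left_pos by blast
  then show ?thesis by (simp add: case_prod_unfold power_mult_distrib)
qed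

text \<open>A summable truncation tends to 0, so it is eventually below \<open>b\<close>, where it
  agrees with \<open>a\<close>.\<close>

lemma not_summable_min:
  fixes a :: "nat \<Rightarrow> real"
  assumes "\<not> summable a" "0 < b" shows "\<not> summable (\<lambda>k. min (a k) b)"
proof
  assume s: "summable (\<lambda>k. min (a k) b)"
  then have "\<forall>\<^sub>F k in sequentially. min (a k) b < b"
    using order_tendstoD(2)[OF summable_LIMSEQ_zero] assms(2) by blast
  then have "\<forall>\<^sub>F k in sequentially. min (a k) b = a k" by eventually_elim auto
  from summable_cong[OF this] show False using s assms(1) by simp
qed

text \<open>
  If the ball carries little mass of the cover, then so does one of its descendants. Otherwise
  every \<open>R k ^ 4\<close> is at most the sum over \<open>i\<close> of the shares \<open>g i (k, x)\<close> below: a set meeting a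
  single descendant pays with its \<open>f\<close>-mass, a set meeting several is so large compared with the
  distances between them that it can pay for all of them in full.
\<close>

lemma exists_light_descendant:
  fixes f :: "real \<Rightarrow> real" and rr :: "nat \<Rightarrow> real"
  assumes f: "dimension_function f" "filterlim (\<lambda>x. f x / x ^ 4) at_top (at_right 0)"
    and rr: "\<And>k. 0 < rr k" "rr \<longlonglongrightarrow> 0" "\<not> summable (\<lambda>k. f (rr k) / spacing k ^ 4)"
    and C: "\<And>i. bounded (C i)" "\<And>i. diameter (C i) \<le> d i" "\<And>i. 0 < d i"
    and r: "0 < r" and G: "0 < G"
    and mass: "hit_mass f C d (cball x0 r) < ennreal (G * r ^ 4 / 2 ^ 26)"
    and hit: "\<And>i. C i \<inter> cball x0 r \<noteq> {} \<Longrightarrow> G * d i ^ 4 \<le> f (d i)"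
  shows "\<exists>k\<ge>k0. \<exists>x\<in>level (8 ^ k). \<exists>\<rho>. 0 < \<rho> \<and> \<rho> \<le> rr k \<and> cball x \<rho> \<subseteq> cball x0 r \<and>
    hit_mass f C d (cball x \<rho>) < ennreal (f \<rho> / 2 ^ 26)"
proof (rule ccontr)
  assume contra: "\<not> ?thesis"
  \<comment> \<open>With this \<open>K\<close>, the mass threshold \<open>v k / 2 ^ 26\<close> of a
    descendant multiplied by \<open>256 / G\<close> is exactly \<open>R k ^ 4\<close>.\<close>
  define K where "K = 2 ^ 18 * G"
  have K: "0 < K" using G by (simp add: K_def)
  \<comment> \<open>The cap forces \<open>2 * R k \<le> spacing k\<close>; where
    \<open>f (rr k)\<close> exceeds it, the intermediate value theorem supplies a smaller
    radius.\<close>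
  define v where "v k = min (f (rr k)) (K * (spacing k / 2) ^ 4)" for k
  have v: "0 < v k" for k
    using dimension_function_pos[OF f(1) rr(1)] K spacing_pos[of k] by (simp add: v_def)
  have "\<exists>\<rho>. 0 < \<rho> \<and> \<rho> \<le> rr k \<and> f \<rho> = v k" for k
  proof -
    have "continuous_on {0..rr k} f"
      using f(1) continuous_on_subset[of "{0..}" f "{0..rr k}"] by (auto simp: dimension_function_def)
    moreover have "f 0 \<le> v k" "v k \<le> f (rr k)"
      using dimension_function_0[OF f(1)] v[of k] by (auto simp: v_def)
    ultimately obtain \<rho> where \<rho>: "0 \<le> \<rho>" "\<rho> \<le> rr k" "f \<rho> = v k"
      using IVT'[of f 0 "v k" "rr k"] rr(1)[of k] by (auto intro: less_imp_le)
    then have "\<rho> \<noteq> 0" using v[of k] dimension_function_0[OF f(1)] by auto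
    with \<rho> show ?thesis by (intro exI[of _ \<rho>]) simp
  qed
  then obtain \<rho> where \<rho>: "\<And>k. 0 < \<rho> k" "\<And>k. \<rho> k \<le> rr k" "\<And>k. f (\<rho> k) = v k" by metis
  define R where "R k = root 4 (v k / K)" for k
  have R4: "R k ^ 4 = v k / K" for k
    using v[of k] K by (simp add: R_def)
  have R0: "0 < R k" for k using v[of k] K by (simp add: R_def)
  have R2: "2 * R k \<le> spacing k" for k
  proof -
    have "R k ^ 4 \<le> (spacing k / 2) ^ 4"
      using K unfolding R4 by (simp add: v_def divide_le_eq mult.commute min_le_iff_disj)
    then have "R k \<le> spacing k / 2" using spacing_pos[of k] R0[of k] by (subst (asm) power_mono_iff) auto
    then show ?thesis by simp
  qed
  have "(R k / spacing k) ^ 4 = min (f (rr k) / spacing k ^ 4 / K) (1 / 16)" for k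
    using spacing_pos[of k] K
    by (simp add: power_divide R4 v_def min_divide_distrib_right field_simps)
  moreover have "\<not> summable (\<lambda>k. f (rr k) / spacing k ^ 4 / K)"
    using rr(3) K summable_mult2[of "\<lambda>k. f (rr k) / spacing k ^ 4 / K" K] by auto
  ultimately have div: "\<not> summable (\<lambda>k. (R k / spacing k) ^ 4)"
    using not_summable_min[of "\<lambda>k. f (rr k) / spacing k ^ 4 / K" "1/16"] by simp
  have "\<forall>\<^sub>F x in at_right 0. 256 * K \<le> f x / x ^ 4"
    using f(2) by (simp add: filterlim_at_top)
  \<comment> \<open>As \<open>f (\<rho> k) = K * R k ^ 4\<close>, the factor
    \<open>256 = 4 ^ 4\<close> will give \<open>\<rho> k \<le> R k / 4\<close>.\<close>
  then obtain \<delta> where \<delta>: "0 < \<delta>" "\<And>x. 0 < x \<Longrightarrow> x < \<delta> \<Longrightarrow> 256 * K \<le> f x / x ^ 4"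
    by (auto simp: eventually_at_right_field)
  have "\<forall>\<^sub>F k in sequentially. rr k < min \<delta> (r / 4)"
    using \<delta>(1) r by (intro order_tendstoD(2)[OF rr(2)]) auto
  \<comment> \<open>Radii below \<open>r / 4\<close> keep balls with centres within
    \<open>3 * r / 4\<close> of \<open>x0\<close> inside \<open>cball x0 r\<close>.\<close>
  then obtain k1 where k1: "\<And>k. k1 \<le> k \<Longrightarrow> rr k < min \<delta> (r / 4)"
    by (auto simp: eventually_sequentially)
  obtain Y where Y: "ball_family R (max k0 k1) x0 (3 * r / 4) Y"
    "r ^ 4 / 2 ^ 18 \<le> (\<Sum>(k, x)\<in>Y. R k ^ 4)"
    using exists_large_ball_family[OF r R0 R2 div] by metis
  have finY: "finite Y" using Y(1) by (simp add: ball_family_def)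
  have YD: "k0 \<le> k" "k1 \<le> k" "x \<in> level (8 ^ k)" "dist x0 x < 3 * r / 4" if "(k, x) \<in> Y" for k x
    using Y(1) that by (auto simp: ball_family_def)
  have \<rho>R: "\<rho> k \<le> R k / 4" if "(k, x) \<in> Y" for k x
  proof -
    have "256 * K \<le> f (\<rho> k) / \<rho> k ^ 4"
      using \<delta>(2)[OF \<rho>(1)] k1[OF YD(2)[OF that]] \<rho>(2)[of k] by force
    then have "256 * K * \<rho> k ^ 4 \<le> v k" using \<rho>(1)[of k] by (simp add: \<rho>(3) pos_le_divide_eq)
    then have "(4 * \<rho> k) ^ 4 \<le> R k ^ 4"
      unfolding R4 pos_le_divide_eq[OF K] by (simp add: power_mult_distrib algebra_simps)
    then have "4 * \<rho> k \<le> R k" using R0[of k] \<rho>(1)[of k] by (subst (asm) power_mono_iff) auto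
    then show ?thesis by simp
  qed
  have sub: "cball x (\<rho> k) \<subseteq> cball x0 r" if "(k, x) \<in> Y" for k x
  proof
    fix z assume "z \<in> cball x (\<rho> k)"
    then show "z \<in> cball x0 r"
      using YD(4)[OF that] k1[OF YD(2)[OF that]] \<rho>(2)[of k] dist_triangle[of x0 z x] by simp
  qed
  have heavy: "ennreal (v k / 2 ^ 26) \<le> hit_mass f C d (cball x (\<rho> k))" if "(k, x) \<in> Y" for k x
    using contra YD(1,3)[OF that] sub[OF that] \<rho>(1)[of k] \<rho>(2)[of k] \<rho>(3)[of k] not_le by metis
  define meets where "meets i = (\<lambda>(k, x). C i \<inter> cball x (\<rho> k) \<noteq> {})" for i
  define g where "g i p = (if \<not> meets i p then 0
      else if \<exists>q\<in>Y. q \<noteq> p \<and> meets i q then ennreal (R (fst p) ^ 4)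
      else ennreal (256 / G * f (d i)))" for i p
  have fd: "0 \<le> f (d i)" for i using dimension_function_nonneg[OF f(1)] C(3) by (simp add: less_imp_le)
  have g1: "ennreal (R k ^ 4) \<le> (\<Sum>i. g i (k, x))" if p: "(k, x) \<in> Y" for k x
  proof (cases "\<exists>i. meets i (k, x) \<and> (\<exists>q\<in>Y. q \<noteq> (k, x) \<and> meets i q)")
    case True
    then obtain i where "meets i (k, x)" "\<exists>q\<in>Y. q \<noteq> (k, x) \<and> meets i q" by blast
    then have "g i (k, x) = ennreal (R k ^ 4)" unfolding g_def by simp
    moreover have "(\<Sum>j\<in>{i}. g j (k, x)) \<le> (\<Sum>i. g i (k, x))" by (intro sum_le_suminf) auto
    ultimately show ?thesis by simp
  next
    case False
    then have "g i (k, x) = ennreal (256 / G) * (if C i \<inter> cball x (\<rho> k) \<noteq> {} then ennreal (f (d i)) else 0)" for i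
      using G fd by (auto simp: g_def meets_def ennreal_mult[symmetric])
    then have "(\<Sum>i. g i (k, x)) = ennreal (256 / G) * hit_mass f C d (cball x (\<rho> k))"
      by (simp add: hit_mass_def)
    moreover have "ennreal (256 / G) * ennreal (v k / 2 ^ 26) \<le> ennreal (256 / G) * hit_mass f C d (cball x (\<rho> k))"
      by (intro mult_left_mono heavy p) simp
    moreover have "ennreal (256 / G) * ennreal (v k / 2 ^ 26) = ennreal (R k ^ 4)"
      using v[of k] G by (simp add: ennreal_mult[symmetric] R4 K_def field_simps)
    ultimately show ?thesis by simp
  qed
  have g2: "(\<Sum>p\<in>Y. g i p) \<le> ennreal (256 / G) * (if C i \<inter> cball x0 r \<noteq> {} then ennreal (f (d i)) else 0)" for i
  proof -
    define J where "J = {p \<in> Y. meets i p}"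
    have gJ: "(\<Sum>p\<in>Y. g i p) = (\<Sum>p\<in>J. g i p)"
      by (rule sum.mono_neutral_right) (use finY in \<open>auto simp: J_def g_def\<close>)
    have hitJ: "C i \<inter> cball x0 r \<noteq> {}" if "p \<in> J" for p
    proof -
      obtain k x where p: "p = (k, x)" by (cases p)
      then show ?thesis using sub[of k x] that by (auto simp: J_def meets_def)
    qed
    consider "J = {}" | p where "J = {p}" | p q where "p \<in> J" "q \<in> J" "p \<noteq> q"
      by blast
    then show ?thesis
    proof cases
      case 1
      then show ?thesis by (simp add: gJ)
    next
      case (2 p)
      then have "g i p = ennreal (256 / G * f (d i))" by (auto simp: J_def g_def)
      then show ?thesis using 2 hitJ[of p] G fd by (simp add: gJ ennreal_mult[symmetric])
    next
      case (3 p q)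
      have "g i p' = ennreal (R (fst p') ^ 4)" if "p' \<in> J" for p'
      proof -
        have "\<exists>q\<in>Y. q \<noteq> p' \<and> meets i q" using 3 by (cases "p = p'") (auto simp: J_def)
        then show ?thesis using that unfolding g_def J_def by simp
      qed
      then have "(\<Sum>p\<in>J. g i p) = ennreal (\<Sum>(k, x)\<in>J. R k ^ 4)"
        by (simp add: case_prod_unfold sum_ennreal)
      also have "\<dots> \<le> ennreal (256 * d i ^ 4)"
        by (intro ennreal_leI sum_pow4_hit_le[where \<rho>=\<rho> and C="C i", OF Y(1) _ \<rho>R C(1,2) _ _ _ 3])
          (use R0 C(3) in \<open>auto simp: J_def meets_def less_imp_le\<close>)
      also have "\<dots> \<le> ennreal (256 / G * f (d i))"
        using hit[OF hitJ[OF 3(1)]] G by (intro ennreal_leI) (simp add: field_simps)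
      finally show ?thesis using hitJ[OF 3(1)] G fd by (simp add: gJ ennreal_mult[symmetric])
    qed
  qed
  \<comment> \<open>Double counting: the shares summed by balls dominate the total volume; summed by
    cover sets they are at most \<open>256 / G\<close> times the mass of the large ball, which is
    too small.\<close>
  have "ennreal (r ^ 4 / 2 ^ 18) \<le> ennreal (\<Sum>(k, x)\<in>Y. R k ^ 4)" by (intro ennreal_leI Y(2))
  also have "\<dots> = (\<Sum>p\<in>Y. ennreal (R (fst p) ^ 4))" by (simp add: case_prod_unfold sum_ennreal)
  also have "\<dots> \<le> (\<Sum>p\<in>Y. \<Sum>i. g i p)" using g1 by (intro sum_mono) auto
  also have "\<dots> = (\<Sum>i. \<Sum>p\<in>Y. g i p)" by (rule suminf_sum[symmetric]) simp
  also have "\<dots> \<le> (\<Sum>i. ennreal (256 / G) * (if C i \<inter> cball x0 r \<noteq> {} then ennreal (f (d i)) else 0))"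
    by (intro suminf_le g2) auto
  also have "\<dots> = ennreal (256 / G) * hit_mass f C d (cball x0 r)" by (simp add: hit_mass_def)
  also have "\<dots> < ennreal (256 / G) * ennreal (G * r ^ 4 / 2 ^ 26)"
    using G by (intro ennreal_mult_strict_left_mono mass) auto
  also have "\<dots> = ennreal (r ^ 4 / 2 ^ 18)"
    using G r by (simp add: ennreal_mult[symmetric])
  finally show False by simp
qed


section \<open>Enlarged diameters, and condensation of the series along the levels\<close>

lemma dimension_function_right_le:
  assumes "dimension_function f" "0 \<le> x" "0 < \<eta>" "0 < \<delta>"
  shows "\<exists>y>x. y < x + \<delta> \<and> f y < f x + \<eta>"
proof -
  have "continuous_on {0..} f" using assms(1) by (simp add: dimension_function_def)
  then obtain e where e: "0 < e" "\<And>y. 0 \<le> y \<Longrightarrow> dist y x < e \<Longrightarrow> dist (f y) (f x) < \<eta>"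
    using assms(2,3) unfolding continuous_on_iff by (metis atLeast_iff)
  define y where "y = x + min e \<delta> / 2"
  have y: "x < y" "y < x + \<delta>" "dist y x < e" using e(1) assms(4) by (auto simp: y_def dist_real_def min_def)
  then have "dist (f y) (f x) < \<eta>" using e(2)[of y] assms(2) by simp
  then have "f y < f x + \<eta>" by (simp add: dist_real_def)
  with y show ?thesis by blast
qed

text \<open>Cauchy condensation with blocks from \<open>2 * 8 ^ k\<close> to
  \<open>2 * 8 ^ Suc k\<close>: a block sum is of order \<open>8 ^ (8 * k)\<close> times a value of
  \<open>f\<close>, and \<open>spacing k ^ 4\<close> is of the inverse order. The argument
  \<open>2 * 8 ^ k\<close> bounds the denominators of the level.\<close>

lemma divergent_along_levels:
  assumes f: "dimension_function f" "antimono_on {0<..} (\<lambda>x. f x / x ^ 4)"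
    and \<Psi>: "approximation_function \<Psi>" "antimono_on {1..} \<Psi>"
    and div: "(\<Sum>m. ennreal (real (Suc m) ^ 7 * f (\<Psi> (Suc m)))) = \<infinity>"
  shows "\<not> summable (\<lambda>k. f (\<Psi> (2 * 8 ^ k) / 2) / spacing k ^ 4)"
proof
  define b where "b m = real m ^ 7 * f (\<Psi> m)" for m
  define a where "a k = f (\<Psi> (2 * 8 ^ k) / 2) / spacing k ^ 4" for k
  assume "summable (\<lambda>k. f (\<Psi> (2 * 8 ^ k) / 2) / spacing k ^ 4)"
  then have suma: "summable a" unfolding a_def[abs_def] .
  have \<Psi>0: "0 < \<Psi> m" if "1 \<le> m" for m using \<Psi>(1) that by (auto simp: approximation_function_def)
  have a0: "0 \<le> a k" for k
    unfolding a_def using \<Psi>0[of "2 * 8 ^ k"] spacing_pos[of k]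
    by (intro divide_nonneg_nonneg dimension_function_nonneg[OF f(1)]) (auto simp: less_imp_le)
  have b0: "0 \<le> b m" if "1 \<le> m" for m
    unfolding b_def using \<Psi>0[OF that] by (intro mult_nonneg_nonneg dimension_function_nonneg[OF f(1)]) auto
  have block: "(\<Sum>m=2 * 8 ^ k..<2 * 8 ^ Suc k. b m) \<le> 2 ^ 64 * a k" for k
  proof -
    have "b m \<le> (16 * 8 ^ k) ^ 7 * f (\<Psi> (2 * 8 ^ k))" if m: "m \<in> {2 * 8 ^ k..<2 * 8 ^ Suc k}" for m
    proof -
      have "(1::nat) \<le> 2 * 8 ^ k" by simp
      with m have m1: "1 \<le> m" by (meson atLeastLessThan_iff order_trans)
      have "real m \<le> 16 * 8 ^ k"
      proof -
        have "m \<le> 16 * 8 ^ k" using m by simp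
        then have "real m \<le> real (16 * 8 ^ k)" by (rule of_nat_mono)
        then show ?thesis by simp
      qed
      moreover have "f (\<Psi> m) \<le> f (\<Psi> (2 * 8 ^ k))"
        using \<Psi>0[OF m1] m m1 monotone_onD[OF \<Psi>(2), of "2 * 8 ^ k" m]
        by (intro dimension_function_mono[OF f(1)]) auto
      ultimately show ?thesis
        unfolding b_def using dimension_function_nonneg[OF f(1), of "\<Psi> m"] \<Psi>0[OF m1]
        by (intro mult_mono power_mono) auto
    qed
    then have "(\<Sum>m=2 * 8 ^ k..<2 * 8 ^ Suc k. b m)
        \<le> real (card {2 * 8 ^ k..<2 * 8 ^ Suc k :: nat}) * ((16 * 8 ^ k) ^ 7 * f (\<Psi> (2 * 8 ^ k)))"
      by (intro sum_bounded_above) auto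
    also have "\<dots> \<le> (16 * 8 ^ k) * ((16 * 8 ^ k) ^ 7 * f (\<Psi> (2 * 8 ^ k)))"
      using dimension_function_nonneg[OF f(1), of "\<Psi> (2 * 8 ^ k)"] \<Psi>0[of "2 * 8 ^ k"]
      by (intro mult_right_mono) auto
    also have "\<dots> = (16 * 8 ^ k) ^ 8 * f (2 * (\<Psi> (2 * 8 ^ k) / 2))" by (simp add: eval_nat_numeral)
    also have "\<dots> \<le> (16 * 8 ^ k) ^ 8 * (16 * f (\<Psi> (2 * 8 ^ k) / 2))"
      using \<Psi>0[of "2 * 8 ^ k"] by (intro mult_left_mono dimension_double_le[OF f]) auto
    \<comment> \<open>\<open>2 ^ 64\<close> collects \<open>16 ^ 8\<close>, the doubling constant 16
      and \<open>128 ^ 4\<close>.\<close>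
    also have "\<dots> = 2 ^ 64 * a k"
    proof -
      have "((8::real) ^ k) ^ 8 = (64 ^ k) ^ 4"
        by (simp add: power_mult[symmetric] mult.commute[of k] power_mult)
      then show ?thesis by (simp add: a_def spacing_def power_mult_distrib power_divide)
    qed
    finally show ?thesis .
  qed
  have sumb: "(\<Sum>m=2..<2 * 8 ^ K. b m) \<le> 2 ^ 64 * suminf a" for K
  proof -
    have "(\<Sum>m=2..<2 * 8 ^ K. b m) \<le> 2 ^ 64 * (\<Sum>k<K. a k)"
    proof (induction K)
      case (Suc K)
      have "(\<Sum>m=2..<2 * 8 ^ Suc K. b m) = (\<Sum>m=2..<2 * 8 ^ K. b m) + (\<Sum>m=2 * 8 ^ K..<2 * 8 ^ Suc K. b m)"
        by (rule sum.atLeastLessThan_concat[symmetric]) auto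
      then show ?case using Suc block[of K] by (simp add: distrib_left)
    qed simp
    also have "\<dots> \<le> 2 ^ 64 * suminf a"
      using suma a0 by (intro mult_left_mono sum_le_suminf) auto
    finally show ?thesis .
  qed
  have "summable (\<lambda>m. b (Suc m))"
  proof (rule bounded_imp_summable)
    show "0 \<le> b (Suc m)" for m using b0 by simp
    fix n
    have lt: "n < 8 ^ n" by (rule less_exp[THEN less_le_trans]) (simp add: power_mono)
    have "(\<Sum>m\<le>n. b (Suc m)) = (\<Sum>m=1..<Suc (Suc n). b m)"
      using sum.shift_bounds_Suc_ivl[of b 0 "Suc n"] by (simp add: atLeast0LessThan lessThan_Suc_atMost)
    \<comment> \<open>The blocks start at 2, so the first term is split off.\<close>
    also have "\<dots> = b 1 + (\<Sum>m=2..<Suc (Suc n). b m)"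
      by (subst sum.atLeast_Suc_lessThan) (auto simp: numeral_2_eq_2)
    also have "(\<Sum>m=2..<Suc (Suc n). b m) \<le> (\<Sum>m=2..<2 * 8 ^ n. b m)"
      using lt b0 by (intro sum_mono2) auto
    finally show "(\<Sum>m\<le>n. b (Suc m)) \<le> b 1 + 2 ^ 64 * suminf a" using sumb[of n] by simp
  qed
  then have "(\<Sum>m. ennreal (b (Suc m))) \<noteq> top" using b0 by (subst suminf_ennreal2) auto
  with div show False by (simp add: b_def)
qed

text \<open>Denominators of a level have norm above \<open>8 ^ k / 64\<close>, so ever higher levels
  give infinitely many pairs. Their norm is at most \<open>2 * 8 ^ k\<close>, whence
  \<open>\<Psi> (2 * 8 ^ k)\<close> bounds the permitted error from below; the factor 1/2 makes the
  inequality strict.\<close>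

lemma approximable_if_near_levels:
  assumes \<Psi>: "approximation_function \<Psi>" "antimono_on {1..} \<Psi>"
    and near: "\<And>n. \<exists>k\<ge>n. \<exists>x\<in>level (8 ^ k). dist x \<xi> \<le> \<Psi> (2 * 8 ^ k) / 2"
  shows "\<xi> \<in> approximable \<Psi>"
proof -
  let ?P = "{(p, q). p \<in> hurwitz \<and> q \<in> hurwitz \<and> q \<noteq> 0 \<and> norm (\<xi> - p \<odot> qinv q) < \<Psi> (nat \<lfloor>norm q\<rfloor>)}"
  have "infinite ?P"
  proof
    assume fin: "finite ?P"
    obtain B where B: "\<And>p q. (p, q) \<in> ?P \<Longrightarrow> norm q \<le> B"
    proof
      show "norm q \<le> Max ((\<lambda>(p, q). norm q) ` ?P)" if "(p, q) \<in> ?P" for p q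
        using fin imageI[OF that, of "\<lambda>(p, q). norm q"] by (intro Max_ge finite_imageI) simp_all
    qed
    obtain n :: nat where n: "64 * B < real n" using reals_Archimedean2 by blast
    obtain k x where k: "n \<le> k" "x \<in> level (8 ^ k)" "dist x \<xi> \<le> \<Psi> (2 * 8 ^ k) / 2"
      using near by blast
    obtain p q where pq: "x = p \<odot> qinv q" "p \<in> lipschitz" "q \<in> lipschitz"
      "real (8 ^ k) / 64 < norm q" "norm q \<le> 2 * real (8 ^ k)"
      using k(2) by (auto simp: level_def)
    have "q \<noteq> 0" using pq(4) by (auto simp: not_less)
    have q: "q \<in> hurwitz" "p \<in> hurwitz" using pq lipschitz_subset_hurwitz by auto
    have "1 \<le> norm q" using norm_hurwitz_ge_1[OF q(1) \<open>q \<noteq> 0\<close>] .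
    then have fl: "1 \<le> nat \<lfloor>norm q\<rfloor>" "nat \<lfloor>norm q\<rfloor> \<le> 2 * 8 ^ k"
    proof -
      have "real_of_int \<lfloor>norm q\<rfloor> \<le> real_of_int (2 * 8 ^ k)" using pq(5) by (simp add: floor_le_iff) linarith
      then show "nat \<lfloor>norm q\<rfloor> \<le> 2 * 8 ^ k" by (simp only: of_int_le_iff) (simp add: nat_le_iff)
    qed (simp add: le_nat_iff)
    then have "\<Psi> (2 * 8 ^ k) \<le> \<Psi> (nat \<lfloor>norm q\<rfloor>)"
      by (intro monotone_onD[OF \<Psi>(2)]) auto
    moreover have "0 < \<Psi> (2 * 8 ^ k)" using \<Psi>(1) by (simp add: approximation_function_def)
    ultimately have "norm (\<xi> - p \<odot> qinv q) < \<Psi> (nat \<lfloor>norm q\<rfloor>)"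
      using k(3) pq(1) by (simp add: dist_norm norm_minus_commute)
    then have "norm q \<le> B" using B q \<open>q \<noteq> 0\<close> by blast
    moreover have "real n < real (8 ^ k)"
    proof -
      have "n < 2 ^ n" by (rule less_exp)
      also have "(2::nat) ^ n \<le> 8 ^ n" by (rule power_mono) auto
      also have "(8::nat) ^ n \<le> 8 ^ k" using k(1) by (rule power_increasing) simp
      finally have "n < 8 ^ k" .
      then show ?thesis by (simp only: of_nat_less_iff)
    qed
    ultimately show False using n pq(4) by simp
  qed
  then show ?thesis by (simp add: approximable_def)
qed

section \<open>Nested light balls and the infinite measure\<close>

lemma cball_subset_Delta_bar: "cball (vector [1/2, 1/2, 1/2, 1/4]) (1/4) \<subseteq> Delta_bar"
proof
  fix z :: quat assume "z \<in> cball (vector [1/2, 1/2, 1/2, 1/4]) (1/4)"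
  then have "norm (z - vector [1/2, 1/2, 1/2, 1/4]) \<le> 1/4" by (simp add: dist_norm norm_minus_commute)
  then have c: "\<bar>z$i - (vector [1/2, 1/2, 1/2, 1/4] :: quat)$i\<bar> \<le> 1/4" for i
    using component_le_norm_cart[of "z - vector [1/2, 1/2, 1/2, 1/4]" i] by simp
  show "z \<in> Delta_bar"
    using c[of 1] c[of 2] c[of 3] c[of 4] unfolding Delta_bar_def vector_4 abs_le_iff mem_Collect_eq atLeastAtMost_iff
    by linarith
qed

lemma cover_misses_approximable:
  fixes f :: "real \<Rightarrow> real"
  assumes f: "dimension_function f" "antimono_on {0<..} (\<lambda>x. f x / x ^ 4)"
      "filterlim (\<lambda>x. f x / x ^ 4) at_top (at_right 0)"
    and \<Psi>: "approximation_function \<Psi>" "antimono_on {1..} \<Psi>"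
    and div: "\<not> summable (\<lambda>k. f (\<Psi> (2 * 8 ^ k) / 2) / spacing k ^ 4)"
    and C: "\<And>i. bounded (C i)" "\<And>i. diameter (C i) \<le> d i" "\<And>i. 0 < d i"
    and r: "0 < r" and G: "0 < G" "\<And>i. G * d i ^ 4 \<le> f (d i)"
    and mass: "hit_mass f C d (cball x0 r) < ennreal (G * r ^ 4 / 2 ^ 26)"
  obtains \<xi> where "\<xi> \<in> cball x0 r" "\<xi> \<in> approximable \<Psi>" "\<And>i. \<xi> \<notin> C i"
proof -
  define rr where "rr k = \<Psi> (2 * 8 ^ k) / 2" for k
  have rr: "0 < rr k" for k using \<Psi>(1) by (simp add: rr_def approximation_function_def)
  have "filterlim (\<lambda>k. 2 * 8 ^ k :: nat) sequentially sequentially"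
    by (rule filterlim_subseq) (simp add: strict_mono_def)
  then have "(\<lambda>k. \<Psi> (2 * 8 ^ k)) \<longlonglongrightarrow> 0"
    using \<Psi>(1) filterlim_compose unfolding approximation_function_def by blast
  then have rr0: "rr \<longlonglongrightarrow> 0" unfolding rr_def[abs_def] by (rule tendsto_divide_zero)
  have rrdiv: "\<not> summable (\<lambda>k. f (rr k) / spacing k ^ 4)" using div by (simp add: rr_def)
  \<comment> \<open>A light ball; the bound \<open>n \<le> k\<close> drives the levels to infinity
    along the construction.\<close>
  define I where "I n = (\<lambda>(k, x, \<rho>). n \<le> k \<and> x \<in> level (8 ^ k) \<and> 0 < \<rho> \<and> \<rho> \<le> rr k \<and>
    cball x \<rho> \<subseteq> cball x0 r \<and> hit_mass f C d (cball x \<rho>) < ennreal (f \<rho> / 2 ^ 26))" for n :: nat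
  \<comment> \<open>A larger set meeting the ball would alone contribute at least
    \<open>f \<rho>\<close>, more than the mass allowed.\<close>
  have small: "d i \<le> \<rho>" if "I n (k, x, \<rho>)" "C i \<inter> cball x \<rho> \<noteq> {}" for n k x \<rho> i
  proof (rule ccontr)
    assume "\<not> d i \<le> \<rho>"
    moreover have \<rho>: "0 < \<rho>" using that(1) by (simp add: I_def)
    ultimately have "f \<rho> \<le> f (d i)" by (intro dimension_function_mono[OF f(1)]) auto
    moreover have "ennreal (f (d i)) < ennreal (f \<rho> / 2 ^ 26)"
      using le_hit_mass[where C=C and f=f and d=d, OF that(2)] that(1) by (auto simp: I_def)
    ultimately show False using dimension_function_pos[OF f(1) \<rho>] by (simp add: ennreal_less_iff)
  qed
  have start: "\<exists>t. I 0 t"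
    using exists_light_descendant[OF f(1,3) rr rr0 rrdiv C r G(1) mass G(2), of 0]
    by (auto simp: I_def)
  have step: "\<exists>t'. I (Suc n) t' \<and> (case t' of (k', x', \<rho>') \<Rightarrow> case t of (k, x, \<rho>) \<Rightarrow> cball x' \<rho>' \<subseteq> cball x \<rho>)"
    if t: "I n t" for n t
  proof -
    obtain k x \<rho> where eq: "t = (k, x, \<rho>)" by (cases t)
    have \<rho>: "0 < \<rho>" using t by (simp add: I_def eq)
    \<comment> \<open>This quotient takes over the role of \<open>G\<close>: it is admissible for
      all sets with \<open>d i \<le> \<rho>\<close> because the quotient decreases, and it turns the
      mass threshold into \<open>f \<rho> / 2 ^ 26\<close>, so lightness reproduces itself.\<close>
    have G': "0 < f \<rho> / \<rho> ^ 4" using \<rho> dimension_function_pos[OF f(1) \<rho>] by simp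
    have hit: "f \<rho> / \<rho> ^ 4 * d i ^ 4 \<le> f (d i)" if "C i \<inter> cball x \<rho> \<noteq> {}" for i
    proof -
      have "d i \<le> \<rho>" using small t that unfolding eq by blast
      then have "f \<rho> / \<rho> ^ 4 \<le> f (d i) / d i ^ 4"
        using C(3)[of i] by (intro monotone_onD[OF f(2)]) auto
      then show ?thesis using C(3)[of i] by (simp add: pos_le_divide_eq)
    qed
    have "hit_mass f C d (cball x \<rho>) < ennreal (f \<rho> / \<rho> ^ 4 * \<rho> ^ 4 / 2 ^ 26)"
      using t \<rho> by (simp add: I_def eq)
    from exists_light_descendant[OF f(1,3) rr rr0 rrdiv C \<rho> G' this hit, of "Suc n"]
    obtain k' x' \<rho>' where "Suc n \<le> k'" "x' \<in> level (8 ^ k')" "0 < \<rho>'" "\<rho>' \<le> rr k'"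
      "cball x' \<rho>' \<subseteq> cball x \<rho>" "hit_mass f C d (cball x' \<rho>') < ennreal (f \<rho>' / 2 ^ 26)"
      by blast
    moreover have "cball x \<rho> \<subseteq> cball x0 r" using t by (simp add: I_def eq)
    ultimately show ?thesis by (intro exI[of _ "(k', x', \<rho>')"]) (auto simp: I_def eq)
  qed
  obtain T where T: "\<And>n. I n (T n)"
    "\<And>n. case T (Suc n) of (k', x', \<rho>') \<Rightarrow> case T n of (k, x, \<rho>) \<Rightarrow> cball x' \<rho>' \<subseteq> cball x \<rho>"
    using dependent_nat_choice[of I "\<lambda>n t t'. case t' of (k', x', \<rho>') \<Rightarrow> case t of (k, x, \<rho>) \<Rightarrow> cball x' \<rho>' \<subseteq> cball x \<rho>"]
      start step by metis
  define k x \<rho> where "k n = fst (T n)" and "x n = fst (snd (T n))" and "\<rho> n = snd (snd (T n))" for n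
  have Teq: "T n = (k n, x n, \<rho> n)" for n by (simp add: k_def x_def \<rho>_def)
  have I: "I n (k n, x n, \<rho> n)" for n using T(1)[of n] by (simp add: Teq)
  have nest: "cball (x (Suc n)) (\<rho> (Suc n)) \<subseteq> cball (x n) (\<rho> n)" for n
    using T(2)[of n] by (simp add: Teq)
  have "(\<Inter>n. cball (x n) (\<rho> n)) \<noteq> {}"
  proof (rule compact_nest)
    show "cball (x n) (\<rho> n) \<noteq> {}" for n using I[of n] by (simp add: I_def)
    show "cball (x n) (\<rho> n) \<subseteq> cball (x m) (\<rho> m)" if "m \<le> n" for m n
      using lift_Suc_antimono_le[of "\<lambda>n. cball (x n) (\<rho> n)", OF nest that] .
  qed auto
  then obtain \<xi> where \<xi>: "\<And>n. \<xi> \<in> cball (x n) (\<rho> n)" by blast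
  show thesis
  proof
    show "\<xi> \<in> cball x0 r" using \<xi>[of 0] I[of 0] by (auto simp: I_def)
    show "\<xi> \<in> approximable \<Psi>"
    proof (rule approximable_if_near_levels[OF \<Psi>])
      fix n
      show "\<exists>k\<ge>n. \<exists>x\<in>level (8 ^ k). dist x \<xi> \<le> \<Psi> (2 * 8 ^ k) / 2"
        using I[of n] \<xi>[of n] by (intro exI[of _ "k n"] conjI bexI[of _ "x n"]) (auto simp: I_def rr_def)
    qed
    \<comment> \<open>A set containing \<open>\<xi>\<close> meets all the nested balls, so its size
      is bounded by radii tending to 0, against \<open>0 < d i\<close>.\<close>
    show "\<xi> \<notin> C i" for i
    proof
      assume "\<xi> \<in> C i"
      have "d i \<le> rr (k n)" for n
      proof -
        have "C i \<inter> cball (x n) (\<rho> n) \<noteq> {}" using \<xi>[of n] \<open>\<xi> \<in> C i\<close> by blast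
        then have "d i \<le> \<rho> n" by (rule small[OF I])
        then show ?thesis using I[of n] by (simp add: I_def)
      qed
      moreover have "\<forall>\<^sub>F n in sequentially. rr n < d i" by (rule order_tendstoD(2)[OF rr0 C(3)])
      then obtain N where "\<And>n. N \<le> n \<Longrightarrow> rr n < d i" by (auto simp: eventually_sequentially)
      moreover have "N \<le> k N" using I[of N] by (simp add: I_def)
      ultimately show False by (meson not_le)
    qed
  qed
qed

lemma hausdorff_measure_approximable_Delta_eq_infinity:
  assumes f: "dimension_function f" "antimono_on {0<..} (\<lambda>x. f x / x ^ 4)"
      "filterlim (\<lambda>x. f x / x ^ 4) at_top (at_right 0)"
    and \<Psi>: "approximation_function \<Psi>" "antimono_on {1..} \<Psi>"
    and div: "(\<Sum>m. ennreal (real (Suc m) ^ 7 * f (\<Psi> (Suc m)))) = \<infinity>"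
  shows "hausdorff_measure f (approximable_Delta \<Psi>) = \<infinity>"
proof (rule ccontr)
  assume "hausdorff_measure f (approximable_Delta \<Psi>) \<noteq> \<infinity>"
  then obtain M where M: "0 \<le> M" "hausdorff_measure f (approximable_Delta \<Psi>) = ennreal M"
    by (cases "hausdorff_measure f (approximable_Delta \<Psi>)") auto
  \<comment> \<open>Makes the threshold \<open>G * (1/4) ^ 4 / 2 ^ 26\<close> equal to
    \<open>M + 3\<close>, while the cover has mass below \<open>M + 1\<close> and its enlargement
    adds at most 1.\<close>
  define G :: real where "G = 2 ^ 34 * (M + 3)"
  have G: "0 < G" using M(1) by (simp add: G_def)
  have "\<forall>\<^sub>F x in at_right 0. G \<le> f x / x ^ 4" using f(3) by (simp add: filterlim_at_top)
  then obtain \<delta> where \<delta>: "0 < \<delta>" "\<And>x. 0 < x \<Longrightarrow> x < \<delta> \<Longrightarrow> G \<le> f x / x ^ 4"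
    by (auto simp: eventually_at_right_field)
  \<comment> \<open>One half of \<open>\<delta>\<close> is for the diameters, the other for
    enlarging them, so that every \<open>d i\<close> stays below \<open>\<delta>\<close>.\<close>
  have "hausdorff_pre f (\<delta>/2) (approximable_Delta \<Psi>) \<le> ennreal M"
    unfolding M(2)[symmetric] hausdorff_measure_SUP using \<delta>(1) by (intro SUP_upper) auto
  also have "\<dots> < ennreal (M + 1)" using M(1) by (simp add: ennreal_less_iff)
  finally obtain C where C: "approximable_Delta \<Psi> \<subseteq> (\<Union>i. C i)"
    "\<And>i. bounded (C i)" "\<And>i. diameter (C i) \<le> \<delta>/2" "(\<Sum>i. ennreal (f (diameter (C i)))) < ennreal (M + 1)"
    unfolding hausdorff_pre_def INF_less_iff by blast
  have "\<exists>y>diameter (C i). y < diameter (C i) + \<delta> / 2 \<and> f y < f (diameter (C i)) + (1/2) ^ Suc i" for i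
    using \<delta>(1) by (intro dimension_function_right_le[OF f(1)] diameter_ge_0 C(2)) auto
  then obtain d where d: "\<And>i. diameter (C i) < d i" "\<And>i. d i < diameter (C i) + \<delta> / 2"
    "\<And>i. f (d i) < f (diameter (C i)) + (1/2) ^ Suc i" by metis
  have d0: "0 < d i" for i using d(1)[of i] diameter_ge_0[OF C(2), of i] by linarith
  have hit: "G * d i ^ 4 \<le> f (d i)" for i
    using \<delta>(2)[OF d0, of i] d(2)[of i] C(3)[of i] d0[of i] by (simp add: pos_le_divide_eq)
  let ?x0 = "vector [1/2, 1/2, 1/2, 1/4] :: quat"
  have "hit_mass f C d (cball ?x0 (1/4)) \<le> (\<Sum>i. ennreal (f (diameter (C i))) + ennreal ((1/2) ^ Suc i))"
    unfolding hit_mass_def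
  proof (intro suminf_le)
    fix i
    have "ennreal (f (d i)) \<le> ennreal (f (diameter (C i)) + (1/2) ^ Suc i)"
      using d(3)[of i] by (intro ennreal_leI) simp
    also have "\<dots> = ennreal (f (diameter (C i))) + ennreal ((1/2) ^ Suc i)"
      by (intro ennreal_plus dimension_function_nonneg[OF f(1)] diameter_ge_0 C(2)) simp
    finally show "(if C i \<inter> cball ?x0 (1/4) \<noteq> {} then ennreal (f (d i)) else 0)
        \<le> ennreal (f (diameter (C i))) + ennreal ((1/2) ^ Suc i)" by simp
  qed auto
  also have "\<dots> = (\<Sum>i. ennreal (f (diameter (C i)))) + (\<Sum>i. ennreal ((1/2) ^ Suc i))"
    by (intro suminf_add[symmetric]) auto
  also have "(\<Sum>i. ennreal ((1/2) ^ Suc i)) = ennreal 1"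
    by (rule suminf_ennreal_eq[OF _ power_half_series]) simp
  also have "(\<Sum>i. ennreal (f (diameter (C i)))) + ennreal 1 \<le> ennreal (M + 1) + ennreal 1"
    using C(4) by (intro add_right_mono less_imp_le)
  also have "\<dots> = ennreal (M + 2)" using M(1) by (subst ennreal_plus[symmetric]) auto
  also have "\<dots> < ennreal (G * (1/4) ^ 4 / 2 ^ 26)"
    using M(1) by (intro ennreal_lessI) (simp_all add: G_def power_divide)
  finally have mass: "hit_mass f C d (cball ?x0 (1/4)) < ennreal (G * (1/4) ^ 4 / 2 ^ 26)" .
  obtain \<xi> where \<xi>: "\<xi> \<in> cball ?x0 (1/4)" "\<xi> \<in> approximable \<Psi>" "\<And>i. \<xi> \<notin> C i"
    using cover_misses_approximable[OF f \<Psi> divergent_along_levels[OF f(1,2) \<Psi> div] C(2)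
        less_imp_le[OF d(1)] d0 _ G hit mass] by auto
  then have "\<xi> \<in> approximable_Delta \<Psi>"
    using cball_subset_Delta_bar by (auto simp: approximable_Delta_def)
  with C(1) \<xi>(3) show False by blast
qed

theorem theorem6p2:
  fixes f :: "real \<Rightarrow> real" and \<Psi> :: "nat \<Rightarrow> real"
  assumes "dimension_function f"
    and "antimono_on {0<..} (\<lambda>x. f x / x ^ 4)"
    and "filterlim (\<lambda>x. f x / x ^ 4) at_top (at_right 0)"
    and "approximation_function \<Psi>"
  shows "((\<Sum>m. ennreal (real (Suc m) ^ 7 * f (\<Psi> (Suc m)))) < \<infinity> \<longrightarrow>
            hausdorff_measure f (approximable \<Psi>) = 0 \<and>
            hausdorff_measure f (approximable_Delta \<Psi>) = 0) \<and>
         (antimono_on {1..} \<Psi> \<and> (\<Sum>m. ennreal (real (Suc m) ^ 7 * f (\<Psi> (Suc m)))) = \<infinity> \<longrightarrow>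
            hausdorff_measure f (approximable \<Psi>) = \<infinity> \<and>
            hausdorff_measure f (approximable_Delta \<Psi>) = \<infinity>)"
proof (intro conjI impI)
  assume "(\<Sum>m. ennreal (real (Suc m) ^ 7 * f (\<Psi> (Suc m)))) < \<infinity>"
  then show W: "hausdorff_measure f (approximable \<Psi>) = 0"
    by (rule hausdorff_measure_approximable_eq_0[OF assms(1,2,4)])
  have "hausdorff_measure f (approximable_Delta \<Psi>) \<le> hausdorff_measure f (approximable \<Psi>)"
    by (rule hausdorff_measure_mono) (simp add: approximable_Delta_def)
  then show "hausdorff_measure f (approximable_Delta \<Psi>) = 0" by (simp add: W)
next
  assume "antimono_on {1..} \<Psi> \<and> (\<Sum>m. ennreal (real (Suc m) ^ 7 * f (\<Psi> (Suc m)))) = \<infinity>"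
  then show V: "hausdorff_measure f (approximable_Delta \<Psi>) = \<infinity>"
    using hausdorff_measure_approximable_Delta_eq_infinity[OF assms] by blast
  \<comment> \<open>Infinite measure passes from the smaller set to the larger one, just as measure
    zero passed in the other direction.\<close>
  have "hausdorff_measure f (approximable_Delta \<Psi>) \<le> hausdorff_measure f (approximable \<Psi>)"
    by (rule hausdorff_measure_mono) (simp add: approximable_Delta_def)
  then show "hausdorff_measure f (approximable \<Psi>) = \<infinity>" by (simp add: V top_unique)
qed

end
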